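(* Let $\mathcal{T}$ be an o-minimal theory extending $\mathrm{Th}(\mathbb{R}_{\exp})$, and let $\mathcal{I}\subseteq\mathbb{R}^d$ be a $\mathcal{T}$-definable invariant for $(A,x)$ (i.e. $x\in\mathcal{I}$ and $A\mathcal{I}\subseteq\mathcal{I}$). Then there exists $t_0\ge1$ such that $P\mathcal{C}_{t_0}\subseteq\mathcal{I}$.
   Context: Setting: $A\in\mathbb{Q}^{d\times d}$ is invertible and $x\in\mathbb{Q}^d$. Write $A=PJP^{-1}$ with $P\in\mathbb{C}^{d\times d}$ invertible and $J=\mathrm{diag}(B_1,\dots,B_k)$ in Jordan normal form, where $B_i\in\mathbb{C}^{d_i\times d_i}$ is a Jordan block with eigenvalue $\rho_i\lambda_i$, $\rho_i>0$ real, $|\lambda_i|=1$, $\sum_i d_i=d$. Coordinates of $\mathbb{C}^d$ are indexed by pairs $(i,j)$, $1\le i\le k$, $1\le j\le d_i$ (row $j$ of block $i$). It is assumed that $\rho_k>1$; put $b_i=\log_{\rho_k}\rho_i$. Let $x'=P^{-1}x$ and for real $s$ let $Q_{i,j}(s)=\sum_{c=0}^{d_i-j}\binom{s}{c}(\rho_i\lambda_i)^{-c}x'_{(i,j+c)}$, where $\binom{s}{c}=\frac{1}{c!}\prod_{r=0}^{c-1}(s-r)$. Let $G=\{v\in\mathbb{Z}^k\mid\lambda_1^{v_1}\cdots\lambda_k^{v_k}=1\}$ and $\mathbb{T}=\{(\alpha_1,\dots,\alpha_k)\in\mathbb{C}^k\mid |\alpha_i|=1\ \forall i,\ \alpha_1^{v_1}\cdots\alpha_k^{v_k}=1\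 \forall v\in G\}$. For $p\in\mathbb{T}$ and $t_0\ge1$ the ray $\mathsf{r}(p,t_0)\subseteq\mathbb{C}^d$ is the set of vectors $y$, for $t\ge t_0$, whose $(i,j)$-coordinate is $t^{b_i}p_iQ_{i,j}(\log_{\rho_k}t)$; the trajectory cone is $\mathcal{C}_{t_0}=\bigcup_{p\in\mathbb{T}}\mathsf{r}(p,t_0)$. $\mathrm{Th}(\mathbb{R}_{\exp})$ is the first-order theory of $\langle\mathbb{R},0,1,+,\cdot,<,x\mapsto e^x\rangle$. A theory is o-minimal if every subset of $\mathbb{R}$ definable in it is a finite union of points and (possibly unbounded) intervals. *)

theory Defs
  imports
    "HOL-Analysis.Topology_Euclidean_Space"
    "Jordan_Normal_Form.Jordan_Normal_Form"
begin

section \<open>First-order logic over the reals\<close>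

text \<open>
  Symbols carry no arity: a symbol applied to argument lists of different lengths plays the role of
  several symbols, one per arity. A language with arities is represented by interpreting each symbol
  as 0 (functions) or False (relations) outside its arity, which adds no definable sets.
\<close>

datatype 'f tm = Var nat | Fn 'f "'f tm list"

datatype ('f, 'r) fm =
    Eq "'f tm" "'f tm"
  | Rel 'r "'f tm list"
  | Neg "('f, 'r) fm"
  | Conj "('f, 'r) fm" "('f, 'r) fm"
  | Ex nat "('f, 'r) fm"

record ('f, 'r) real_structure =
  fun_interp :: "'f \<Rightarrow> real list \<Rightarrow> real"
  rel_interp :: "'r \<Rightarrow> real list \<Rightarrow> bool"

fun tm_val :: "('f, 'r) real_structure \<Rightarrow> (nat \<Rightarrow> real) \<Rightarrow> 'f tm \<Rightarrow> real" where
  "tm_val M e (Var n) = e n"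
| "tm_val M e (Fn f ts) = fun_interp M f (map (tm_val M e) ts)"

fun sat :: "('f, 'r) real_structure \<Rightarrow> (nat \<Rightarrow> real) \<Rightarrow> ('f, 'r) fm \<Rightarrow> bool" where
  "sat M e (Eq s t) \<longleftrightarrow> tm_val M e s = tm_val M e t"
| "sat M e (Rel r ts) \<longleftrightarrow> rel_interp M r (map (tm_val M e) ts)"
| "sat M e (Neg \<phi>) \<longleftrightarrow> \<not> sat M e \<phi>"
| "sat M e (Conj \<phi> \<psi>) \<longleftrightarrow> sat M e \<phi> \<and> sat M e \<psi>"
| "sat M e (Ex n \<phi>) \<longleftrightarrow> (\<exists>a. sat M (e(n := a)) \<phi>)"

fun fv_tm :: "'f tm \<Rightarrow> nat set" where
  "fv_tm (Var n) = {n}"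
| "fv_tm (Fn f ts) = (\<Union>t\<in>set ts. fv_tm t)"

fun fv :: "('f, 'r) fm \<Rightarrow> nat set" where
  "fv (Eq s t) = fv_tm s \<union> fv_tm t"
| "fv (Rel r ts) = (\<Union>t\<in>set ts. fv_tm t)"
| "fv (Neg \<phi>) = fv \<phi>"
| "fv (Conj \<phi> \<psi>) = fv \<phi> \<union> fv \<psi>"
| "fv (Ex n \<phi>) = fv \<phi> - {n}"

definition Th :: "('f, 'r) real_structure \<Rightarrow> ('f, 'r) fm set" where
  "Th M = {\<phi>. fv \<phi> = {} \<and> (\<forall>e. sat M e \<phi>)}"

subsection \<open>The real exponential field and its expansions\<close>

datatype exp_fun = Zero | One | Plus | Times | Exp
datatype exp_rel = Less

fun exp_fun_interp :: "exp_fun \<Rightarrow> real list \<Rightarrow> real" where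
  "exp_fun_interp Zero [] = 0"
| "exp_fun_interp One [] = 1"
| "exp_fun_interp Plus [a, b] = a + b"
| "exp_fun_interp Times [a, b] = a * b"
| "exp_fun_interp Exp [a] = exp a"
| "exp_fun_interp _ _ = 0"

fun exp_rel_interp :: "exp_rel \<Rightarrow> real list \<Rightarrow> bool" where
  "exp_rel_interp Less [a, b] \<longleftrightarrow> a < b"
| "exp_rel_interp Less _ \<longleftrightarrow> False"

definition R_exp :: "(exp_fun, exp_rel) real_structure" where
  "R_exp = \<lparr>fun_interp = exp_fun_interp, rel_interp = exp_rel_interp\<rparr>"

text \<open>
  The theories under consideration are theories \<open>Th M\<close> of structures on the real line itself, since
  definability and o-minimality refer to subsets of the reals. The language of \<open>M\<close> adds arbitrary
  function symbols \<open>'f\<close> and relation symbols \<open>'r\<close> to that of \<open>R_exp\<close>, whose symbols keep their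
  standard meaning.
\<close>

definition expands_R_exp :: "(exp_fun + 'f, exp_rel + 'r) real_structure \<Rightarrow> bool" where
  "expands_R_exp M \<longleftrightarrow>
     (\<forall>f as. fun_interp M (Inl f) as = fun_interp R_exp f as) \<and>
     (\<forall>r as. rel_interp M (Inl r) as = rel_interp R_exp r as)"

lemma tm_val_map_tm_Inl:
  assumes "expands_R_exp M"
  shows "tm_val M e (map_tm Inl t) = tm_val R_exp e t"
  using assms by (induction t) (simp_all add: expands_R_exp_def comp_def cong: map_cong)

lemma sat_map_fm_Inl:
  assumes "expands_R_exp M"
  shows "sat M e (map_fm Inl Inl \<phi>) \<longleftrightarrow> sat R_exp e \<phi>"
  using assms
  by (induction \<phi> arbitrary: e)
    (simp_all add: tm_val_map_tm_Inl[OF assms] expands_R_exp_def comp_def)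

lemma fv_tm_map_tm: "fv_tm (map_tm g t) = fv_tm t"
  by (induction t) auto

lemma fv_map_fm: "fv (map_fm g h \<phi>) = fv \<phi>"
  by (induction \<phi>) (auto simp: fv_tm_map_tm)

lemma Th_R_exp_subset_Th:
  assumes "expands_R_exp M"
  shows "map_fm Inl Inl ` Th R_exp \<subseteq> Th M"
  using sat_map_fm_Inl[OF assms] by (auto simp: Th_def fv_map_fm)

subsection \<open>Definability and o-minimality\<close>

text \<open>
  Definability is with real parameters: variables \<open>0, \<dots>, d - 1\<close> range over the coordinates, and
  \<open>e\<close> supplies values for the remaining free variables of the formula.
\<close>

definition definable :: "('f, 'r) real_structure \<Rightarrow> nat \<Rightarrow> real vec set \<Rightarrow> bool" where
  "definable M d S \<longleftrightarrow>
     (\<exists>\<phi> e. S = {v \<in> carrier_vec d. sat M (\<lambda>i. if i < d then v $ i else e i) \<phi>})"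

text \<open>Points are the one-element intervals; \<^const>\<open>is_interval\<close> allows unbounded intervals.\<close>

definition o_minimal :: "('f, 'r) real_structure \<Rightarrow> bool" where
  "o_minimal M \<longleftrightarrow>
     (\<forall>S :: real set. definable M 1 ((\<lambda>a. vec 1 (\<lambda>_. a)) ` S) \<longrightarrow>
        (\<exists>F. finite F \<and> (\<forall>J\<in>F. is_interval J) \<and> S = \<Union>F))"

section \<open>Linear loops and trajectory cones\<close>

definition loop_invariant :: "rat mat \<Rightarrow> rat vec \<Rightarrow> real vec set \<Rightarrow> bool" where
  "loop_invariant A x I \<longleftrightarrow>
     map_vec of_rat x \<in> I \<and> (\<forall>v\<in>I. map_mat of_rat A *\<^sub>v v \<in> I)"

text \<open>
  Blocks and rows are numbered from 0: block \<open>i < k\<close> has size \<open>ds i\<close> and eigenvalue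
  \<open>\<rho> i * lam i\<close>, the last block is \<open>k - 1\<close>, and row \<open>j < ds i\<close> of block \<open>i\<close> is coordinate
  \<open>block_pos ds i j\<close> of the whole space.
\<close>

definition block_list ::
  "nat \<Rightarrow> (nat \<Rightarrow> nat) \<Rightarrow> (nat \<Rightarrow> real) \<Rightarrow> (nat \<Rightarrow> complex) \<Rightarrow> (nat \<times> complex) list" where
  "block_list k ds \<rho> lam = map (\<lambda>i. (ds i, of_real (\<rho> i) * lam i)) [0..<k]"

definition block_pos :: "(nat \<Rightarrow> nat) \<Rightarrow> nat \<Rightarrow> nat \<Rightarrow> nat" where
  "block_pos ds i j = (\<Sum>l<i. ds l) + j"

text \<open>With rows numbered from 0, the summation range \<open>0 \<le> c \<le> d\<^sub>i - j\<close> becomes \<open>c < ds i - j\<close>.\<close>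

definition Q_poly ::
  "(nat \<Rightarrow> nat) \<Rightarrow> (nat \<Rightarrow> real) \<Rightarrow> (nat \<Rightarrow> complex) \<Rightarrow> complex vec \<Rightarrow> nat \<Rightarrow> nat \<Rightarrow> real \<Rightarrow> complex" where
  "Q_poly ds \<rho> lam x' i j s =
     (\<Sum>c<ds i - j. of_real (s gchoose c) * (of_real (\<rho> i) * lam i) powi (- int c)
                     * x' $ block_pos ds i (j + c))"

text \<open>Only the values at indices below \<open>k\<close> matter for the members of the following two sets.\<close>

definition mult_relations :: "nat \<Rightarrow> (nat \<Rightarrow> complex) \<Rightarrow> (nat \<Rightarrow> int) set" where
  "mult_relations k lam = {v. (\<Prod>i<k. lam i powi v i) = 1}"

definition torus :: "nat \<Rightarrow> (nat \<Rightarrow> complex) \<Rightarrow> (nat \<Rightarrow> complex) set" where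
  "torus k lam =
     {\<alpha>. (\<forall>i<k. cmod (\<alpha> i) = 1) \<and> (\<forall>v\<in>mult_relations k lam. (\<Prod>i<k. \<alpha> i powi v i) = 1)}"

definition ray ::
  "nat \<Rightarrow> (nat \<Rightarrow> nat) \<Rightarrow> (nat \<Rightarrow> real) \<Rightarrow> (nat \<Rightarrow> complex) \<Rightarrow> complex vec
     \<Rightarrow> (nat \<Rightarrow> complex) \<Rightarrow> real \<Rightarrow> complex vec set" where
  "ray k ds \<rho> lam x' p t0 =
     {y \<in> carrier_vec (\<Sum>i<k. ds i). \<exists>t\<ge>t0. \<forall>i<k. \<forall>j<ds i.
        y $ block_pos ds i j =
          of_real (t powr log (\<rho> (k - 1)) (\<rho> i)) * p i
            * Q_poly ds \<rho> lam x' i j (log (\<rho> (k - 1)) t)}"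

definition trajectory_cone ::
  "nat \<Rightarrow> (nat \<Rightarrow> nat) \<Rightarrow> (nat \<Rightarrow> real) \<Rightarrow> (nat \<Rightarrow> complex) \<Rightarrow> complex vec
     \<Rightarrow> real \<Rightarrow> complex vec set" where
  "trajectory_cone k ds \<rho> lam x' t0 = (\<Union>p\<in>torus k lam. ray k ds \<rho> lam x' p t0)"

end

theory Submission
  imports Defs "HOL-Analysis.Continuum_Not_Denumerable"
begin

text \<open>
  Write \<open>s\<close> for the logarithm of \<open>t\<close> and call \<open>(p, s)\<close> good if the point of the ray of \<open>p\<close> at \<open>t\<close> is
  mapped into the invariant. Applying \<open>A\<close> moves \<open>(p, s)\<close> to \<open>(lam p, s + 1)\<close>, so goodness propagates
  along this map, and the orbit of \<open>x\<close> makes all \<open>(lam ^ n, n)\<close> good. By o-minimality, for fixed \<open>p\<close>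
  goodness is eventually constant in \<open>s\<close>. The torus has a definable (rational) chart by \<open>\<real>\<^sup>k\<close>, and a
  countable cover of a box by definable sets has a member that contains a box; hence on some open
  part \<open>U\<close> of the torus goodness is constant for all \<open>s > m\<close>. The powers of \<open>lam\<close> are dense in the
  torus and visit \<open>U\<close> infinitely often, so this constant is True, and finitely many translates of
  \<open>U\<close> by powers of \<open>lam\<close> cover the torus.
\<close>

section \<open>Definable predicates\<close>

text \<open>Two obstacles shape the proof. A continuous version of the rotation, \<open>lam\<close>
  to a real power \<open>s\<close>, would in general bring in the sine on the whole line, which no
  o-minimal structure defines. Hence the phase \<open>p\<close> is kept apart from \<open>s\<close>:
  for fixed \<open>p\<close> a ray depends on \<open>s\<close> through exponentials and polynomials
  only.

  The other obstacle is uniformity. The threshold beyond which goodness is constant depends on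
  \<open>p\<close>, and compactness alone does not bound it, since the set of good phases need not
  be open. The remedy is of Baire type: thresholds can be taken in the naturals, so countably many
  definable sets cover the parameters, and a definable subset of the line is finite unless it
  contains an interval. O-minimality speaks of one variable only; the passage to boxes quantifies
  over sections, which is why definable predicates must be closed under quantifiers and must admit
  arbitrary real parameters.

  Density of the orbit is Kronecker's theorem, obtained here by averaging a nonnegative
  trigonometric kernel along the orbit.\<close>

text \<open>Even indices hold the variables and odd indices the parameters, so that there is always room
  for further parameters and for fresh bound variables.\<close>

definition interleave :: "(nat \<Rightarrow> real) \<Rightarrow> (nat \<Rightarrow> real) \<Rightarrow> nat \<Rightarrow> real" where
  "interleave e p i = (if even i then e (i div 2) else p (i div 2))"

text \<open>A semantic stand-in for formulas: with the parameters hidden, closure properties can be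
  chained as introduction rules, and the formula describing goodness never has to be written
  out.\<close>

definition dpred :: "('f, 'r) real_structure \<Rightarrow> ((nat \<Rightarrow> real) \<Rightarrow> bool) \<Rightarrow> bool" where
  "dpred M Q \<longleftrightarrow> (\<exists>\<phi> p. \<forall>e. Q e \<longleftrightarrow> sat M (interleave e p) \<phi>)"

fun rename_tm :: "(nat \<Rightarrow> nat) \<Rightarrow> 'f tm \<Rightarrow> 'f tm" where
  "rename_tm g (Var n) = Var (g n)"
| "rename_tm g (Fn f ts) = Fn f (map (rename_tm g) ts)"

fun rename_fm :: "(nat \<Rightarrow> nat) \<Rightarrow> ('f, 'r) fm \<Rightarrow> ('f, 'r) fm" where
  "rename_fm g (Eq s t) = Eq (rename_tm g s) (rename_tm g t)"
| "rename_fm g (Rel r ts) = Rel r (map (rename_tm g) ts)"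
| "rename_fm g (Neg \<phi>) = Neg (rename_fm g \<phi>)"
| "rename_fm g (Conj \<phi> \<psi>) = Conj (rename_fm g \<phi>) (rename_fm g \<psi>)"
| "rename_fm g (Ex n \<phi>) = Ex (g n) (rename_fm g \<phi>)"

lemma tm_val_rename_tm: "tm_val M e (rename_tm g t) = tm_val M (e \<circ> g) t"
  by (induction t) (simp_all add: comp_def cong: map_cong)

text \<open>Bound variables are renamed together with the free ones, so injectivity is what rules
  out capture.\<close>

lemma sat_rename_fm:
  assumes "inj g"
  shows "sat M e (rename_fm g \<phi>) \<longleftrightarrow> sat M (e \<circ> g) \<phi>"
proof (induction \<phi> arbitrary: e)
  case (Ex n \<phi>)
  have "e(g n := a) \<circ> g = (e \<circ> g)(n := a)" for a
    using assms by (auto simp: fun_eq_iff inj_eq)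
  then show ?case by (simp only: rename_fm.simps sat.simps Ex.IH)
qed (simp_all add: tm_val_rename_tm comp_def cong: map_cong)

lemma dpredI: "(\<And>e. Q e \<longleftrightarrow> sat M (interleave e p) \<phi>) \<Longrightarrow> dpred M Q"
  unfolding dpred_def by blast

lemma interleave_simps [simp]:
  "interleave e p (2 * i) = e i" "interleave e p (Suc (2 * i)) = p i"
  by (simp_all add: interleave_def)

lemma dpred_neg: "dpred M Q \<Longrightarrow> dpred M (\<lambda>e. \<not> Q e)"
  unfolding dpred_def by (metis sat.simps(3))

lemma dpred_conj:
  assumes "dpred M Q" "dpred M R"
  shows "dpred M (\<lambda>e. Q e \<and> R e)"
proof -
  obtain \<phi> p where \<phi>: "\<And>e. Q e \<longleftrightarrow> sat M (interleave e p) \<phi>"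
    using assms(1) unfolding dpred_def by blast
  obtain \<psi> q where \<psi>: "\<And>e. R e \<longleftrightarrow> sat M (interleave e q) \<psi>"
    using assms(2) unfolding dpred_def by blast
  \<comment> \<open>The two formulas have unrelated parameters. Index \<open>2 * j + 1\<close> goes
    to \<open>4 * j + 1\<close> under \<open>g\<close> and to \<open>4 * j + 3\<close> under
    \<open>h\<close>, where \<open>interleave p q\<close> stores \<open>p j\<close> and
    \<open>q j\<close>; the variables at even indices stay shared.\<close>
  define g h :: "nat \<Rightarrow> nat" where "g i = (if even i then i else 2 * i - 1)"
    and "h i = (if even i then i else 2 * i + 1)" for i
  have inj: "inj g" "inj h"
    unfolding inj_def g_def h_def by (presburger)+
  have g: "interleave e (interleave p q) \<circ> g = interleave e p" for e
  proof
    fix i show "(interleave e (interleave p q) \<circ> g) i = interleave e p i"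
    proof (cases "even i")
      case False
      then obtain j where "i = 2 * j + 1" by (auto elim: oddE)
      then have "g i = Suc (2 * (2 * j))" by (simp add: g_def)
      then show ?thesis using \<open>i = 2 * j + 1\<close> by (simp only: o_def interleave_simps) simp
    qed (simp add: g_def interleave_def)
  qed
  have h: "interleave e (interleave p q) \<circ> h = interleave e q" for e
  proof
    fix i show "(interleave e (interleave p q) \<circ> h) i = interleave e q i"
    proof (cases "even i")
      case False
      then obtain j where "i = 2 * j + 1" by (auto elim: oddE)
      then have "h i = Suc (2 * (Suc (2 * j)))" by (simp add: h_def)
      then show ?thesis using \<open>i = 2 * j + 1\<close> by (simp only: o_def interleave_simps) simp
    qed (simp add: h_def interleave_def)
  qed
  show ?thesis
    by (rule dpredI[where p = "interleave p q" and \<phi> = "Conj (rename_fm g \<phi>) (rename_fm h \<psi>)"])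
      (simp add: sat_rename_fm inj g h \<phi> \<psi>)
qed

lemma dpred_disj: "dpred M Q \<Longrightarrow> dpred M R \<Longrightarrow> dpred M (\<lambda>e. Q e \<or> R e)"
  using dpred_neg[OF dpred_conj[OF dpred_neg dpred_neg, of M Q R]] by simp

lemma dpred_rename:
  assumes "dpred M Q" "inj g"
  shows "dpred M (\<lambda>e. Q (e \<circ> g))"
proof -
  obtain \<phi> p where \<phi>: "\<And>e. Q e \<longleftrightarrow> sat M (interleave e p) \<phi>"
    using assms(1) unfolding dpred_def by blast
  define h where "h i = (if even i then 2 * g (i div 2) else i)" for i
  have "inj h"
  proof (rule injI)
    fix i j assume "h i = h j"
    then show "i = j" using assms(2) unfolding h_def
      by (auto split: if_splits simp: inj_eq)
  qed
  moreover have "interleave e p \<circ> h = interleave (e \<circ> g) p" for e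
    by (auto simp: fun_eq_iff h_def interleave_def)
  ultimately show ?thesis
    by (intro dpredI[where p = p and \<phi> = "rename_fm h \<phi>"]) (simp add: sat_rename_fm \<phi>)
qed

lemma dpred_ex_upd:
  assumes "dpred M Q"
  shows "dpred M (\<lambda>e. \<exists>a. Q (e(n := a)))"
proof -
  obtain \<phi> p where \<phi>: "\<And>e. Q e \<longleftrightarrow> sat M (interleave e p) \<phi>"
    using assms unfolding dpred_def by blast
  have "interleave (e(n := a)) p = (interleave e p)(2 * n := a)" for e a
    by (auto simp: fun_eq_iff interleave_def)
  then show ?thesis
    by (intro dpredI[where p = p and \<phi> = "Ex (2 * n) \<phi>"]) (simp add: \<phi>)
qed

text \<open>Binding with a shift: the bound value is pushed in front of the other variables. This is
  the form that substitution of definable functions uses.\<close>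

lemma dpred_ex:
  assumes "dpred M Q"
  shows "dpred M (\<lambda>e. \<exists>a. Q (case_nat a e))"
proof -
  obtain \<phi> p where \<phi>: "\<And>e. Q e \<longleftrightarrow> sat M (interleave e p) \<phi>"
    using assms unfolding dpred_def by blast
  \<comment> \<open>The parameters move up by one place, which frees index 1 for the bound variable;
    the dummy parameter 0 there is overwritten. Variable 0 goes to that slot and the later variables
    move down.\<close>
  define h :: "nat \<Rightarrow> nat"
    where "h i = (if i = 0 then 1 else if even i then i - 2 else i + 2)" for i
  have "inj h" unfolding inj_def h_def by presburger
  moreover have "(interleave e (case_nat 0 p))(Suc 0 := a) \<circ> h = interleave (case_nat a e) p" for e a
  proof
    fix i
    consider "i = 0" | j where "i = 2 * Suc j" | j where "i = Suc (2 * j)"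
      by (metis (no_types) mult_0_right not0_implies_Suc oddE evenE Suc_eq_plus1)
    then show "((interleave e (case_nat 0 p))(Suc 0 := a) \<circ> h) i = interleave (case_nat a e) p i"
    proof cases
      case (3 j)
      then have "h i = Suc (2 * Suc j)" by (simp add: h_def)
      then show ?thesis unfolding 3
        by (simp only: o_def fun_upd_apply interleave_simps nat.case) (simp del: mult_Suc_right)
    next
      case (2 j)
      then have "h i = 2 * j" by (simp add: h_def)
      then show ?thesis unfolding 2 by (simp only: o_def interleave_simps fun_upd_apply) auto
    qed (simp add: h_def interleave_def)
  qed
  ultimately show ?thesis
    by (intro dpredI[where p = "case_nat 0 p" and \<phi> = "Ex 1 (rename_fm h \<phi>)"])
      (simp add: sat_rename_fm \<phi>)
qed

lemma dpred_all_upd: "dpred M Q \<Longrightarrow> dpred M (\<lambda>e. \<forall>a. Q (e(n := a)))"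
  using dpred_neg[OF dpred_ex_upd[OF dpred_neg, of M Q n]] by simp

subsection \<open>Definable functions\<close>

text \<open>Definability of the graph, not existence of a term, so that division and real or
  imaginary parts are covered. Slot 0 is reserved for the value.\<close>

definition dfun :: "('f, 'r) real_structure \<Rightarrow> ((nat \<Rightarrow> real) \<Rightarrow> real) \<Rightarrow> bool" where
  "dfun M F \<longleftrightarrow> dpred M (\<lambda>e. e 0 = F (e \<circ> Suc))"

lemma case_nat_comp_Suc [simp]: "case_nat a e \<circ> Suc = e"
  by (simp add: fun_eq_iff)

text \<open>Substitution is quantification over the value: some \<open>a\<close> equals
  \<open>F e\<close> and satisfies \<open>Q\<close> when put in front of \<open>e\<close>.\<close>

lemma dpred_subst:
  assumes "dpred M Q" "dfun M F"
  shows "dpred M (\<lambda>e. Q (case_nat (F e) e))"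
  using dpred_ex[OF dpred_conj[OF assms(2)[unfolded dfun_def] assms(1)]] by simp

lemma dfun_comp_Suc:
  assumes "dfun M F"
  shows "dfun M (\<lambda>e. F (e \<circ> Suc))"
proof -
  have "inj (case_nat 0 (\<lambda>n. Suc (Suc n)))"
    by (auto simp: inj_def split: nat.splits)
  from dpred_rename[OF assms[unfolded dfun_def] this] show ?thesis
    by (simp add: dfun_def o_def)
qed

lemma dpred_subst_many:
  assumes "dpred M Q" "\<And>i. i < n \<Longrightarrow> dfun M (F i)"
  shows "dpred M (\<lambda>e. Q (\<lambda>i. if i < n then F i e else e (i - n)))"
  using assms(2)
proof (induction n arbitrary: F)
  case 0
  then show ?case using assms(1) by simp
next
  case (Suc n)
  \<comment> \<open>Substituting \<open>F n\<close> afterwards puts its value at the front of the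
    environment, so the other functions must first be shifted past that slot.\<close>
  have "dpred M (\<lambda>e. Q (\<lambda>i. if i < n then F i (e \<circ> Suc) else e (i - n)))"
    by (rule Suc.IH) (use Suc.prems in \<open>auto intro!: dfun_comp_Suc[unfolded o_def] simp: o_def\<close>)
  from dpred_subst[OF this Suc.prems[of n]]
  have *: "dpred M (\<lambda>e. Q (\<lambda>i. if i < n then F i e else case_nat (F n e) e (i - n)))"
    by (simp only: case_nat_comp_Suc)
  have "(\<lambda>i. if i < n then F i e else case_nat (F n e) e (i - n))
      = (\<lambda>i. if i < Suc n then F i e else e (i - Suc n))" for e
    by (auto simp: fun_eq_iff less_Suc_eq split: nat.split intro!: arg_cong[where f = e])
  then show ?case using * by simp
qed

lemma dfun_binary:
  assumes "dpred M (\<lambda>e. R (e 0) (e 1) (e 2))" "dfun M F" "dfun M G"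
    and "\<And>a b c. R a b c \<longleftrightarrow> c = f a b"
  shows "dfun M (\<lambda>e. f (F e) (G e))"
proof -
  let ?H = "\<lambda>i::nat. if i = 0 then (\<lambda>e. F (e \<circ> Suc)) else if i = 1 then (\<lambda>e. G (e \<circ> Suc)) else (\<lambda>e. e 0)"
  have "dpred M (\<lambda>e. R ((\<lambda>i. if i < 2 then ?H i e else e (i - 2)) 0)
     ((\<lambda>i. if i < 2 then ?H i e else e (i - 2)) 1) ((\<lambda>i. if i < 2 then ?H i e else e (i - 2)) 2))"
    by (rule dpred_subst_many[OF assms(1), of 2]) (auto intro!: dfun_comp_Suc[unfolded o_def] assms(2,3) simp: o_def)
  then show ?thesis unfolding dfun_def by (simp add: assms(4))
qed

lemma dpred_binary:
  assumes "dpred M (\<lambda>e. R (e 0) (e 1))" "dfun M F" "dfun M G"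
  shows "dpred M (\<lambda>e. R (F e) (G e))"
proof -
  let ?H = "\<lambda>i::nat. if i = 0 then F else G"
  have "dpred M (\<lambda>e. R ((\<lambda>i. if i < 2 then ?H i e else e (i - 2)) 0)
     ((\<lambda>i. if i < 2 then ?H i e else e (i - 2)) 1))"
    by (rule dpred_subst_many[OF assms(1), of 2]) (auto intro: assms(2,3))
  then show ?thesis by simp
qed

lemma dfun_var: "dfun M (\<lambda>e. e i)"
  unfolding dfun_def
  by (rule dpredI[where \<phi> = "Eq (Var 0) (Var (2 * Suc i))"])
    (simp only: sat.simps tm_val.simps interleave_simps, simp add: interleave_def)

lemma dfun_const: "dfun M (\<lambda>e. c)"
  unfolding dfun_def
  by (rule dpredI[where \<phi> = "Eq (Var 0) (Var 1)" and p = "\<lambda>_. c"]) (simp add: interleave_def)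

lemma dpred_const: "dpred M (\<lambda>e. b)"
proof (cases b)
  case True
  then show ?thesis by (auto intro!: dpredI[where \<phi> = "Eq (Var 0) (Var 0)"])
next
  case False
  then show ?thesis by (auto intro!: dpredI[where \<phi> = "Neg (Eq (Var 0) (Var 0))"])
qed

lemma dpred_eq:
  assumes "dfun M F" "dfun M G"
  shows "dpred M (\<lambda>e. F e = G e)"
  by (rule dpred_binary[OF _ assms])
    (rule dpredI[where \<phi> = "Eq (Var 0) (Var 2)"], simp add: interleave_def)

lemma dpred_all_less:
  "(\<And>i. i < n \<Longrightarrow> dpred M (Q i)) \<Longrightarrow> dpred M (\<lambda>e. \<forall>i<n::nat. Q i e)"
  by (induction n) (auto simp: less_Suc_eq all_conj_distrib imp_conjR dpred_const intro: dpred_conj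
      cong: conj_cong)

locale exp_expansion =
  fixes M :: "(exp_fun + 'f, exp_rel + 'r) real_structure"
  assumes expands: "expands_R_exp M"
begin

lemma interp [simp]:
  "fun_interp M (Inl f) as = exp_fun_interp f as" "rel_interp M (Inl r) as = exp_rel_interp r as"
  using expands by (auto simp: expands_R_exp_def R_exp_def)

lemma dfun_add: "dfun M F \<Longrightarrow> dfun M G \<Longrightarrow> dfun M (\<lambda>e. F e + G e)"
  by (rule dfun_binary[where R = "\<lambda>a b c. c = a + b"])
    (rule dpredI[where \<phi> = "Eq (Var 4) (Fn (Inl Plus) [Var 0, Var 2])"],
      auto simp: interleave_def)

lemma dfun_mult: "dfun M F \<Longrightarrow> dfun M G \<Longrightarrow> dfun M (\<lambda>e. F e * G e)"
  by (rule dfun_binary[where R = "\<lambda>a b c. c = a * b"])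
    (rule dpredI[where \<phi> = "Eq (Var 4) (Fn (Inl Times) [Var 0, Var 2])"],
      auto simp: interleave_def)

lemma dfun_exp: "dfun M F \<Longrightarrow> dfun M (\<lambda>e. exp (F e))"
  by (rule dfun_binary[where R = "\<lambda>a b c. c = exp a" and f = "\<lambda>a b. exp a"])
    (rule dpredI[where \<phi> = "Eq (Var 4) (Fn (Inl Exp) [Var 0])"],
      auto simp: interleave_def)

lemma dpred_less: "dfun M F \<Longrightarrow> dfun M G \<Longrightarrow> dpred M (\<lambda>e. F e < G e)"
  by (rule dpred_binary)
    (rule dpredI[where \<phi> = "Rel (Inl Less) [Var 0, Var 2]"], auto simp: interleave_def)

lemma dfun_uminus: "dfun M F \<Longrightarrow> dfun M (\<lambda>e. - F e)"
  using dfun_mult[OF dfun_const[of M "-1"], of F] by simp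

lemma dfun_diff: "dfun M F \<Longrightarrow> dfun M G \<Longrightarrow> dfun M (\<lambda>e. F e - G e)"
  using dfun_add[OF _ dfun_uminus, of F G] by simp

lemma dfun_divide:
  assumes "dfun M F" "dfun M G"
  shows "dfun M (\<lambda>e. F e / G e)"
proof (rule dfun_binary[OF _ assms])
  \<comment> \<open>The second disjunct is the convention that division by 0 gives 0.\<close>
  show "dpred M (\<lambda>e. (\<not> e 1 = 0 \<and> e 2 * e 1 = e 0) \<or> (e 1 = 0 \<and> e 2 = 0))"
    by (intro dpred_disj dpred_conj dpred_neg dpred_eq dfun_mult dfun_var dfun_const)
qed (auto simp: field_simps)

lemma dfun_prod:
  "finite S \<Longrightarrow> (\<And>i. i \<in> S \<Longrightarrow> dfun M (F i)) \<Longrightarrow> dfun M (\<lambda>e. \<Prod>i\<in>S. F i e)"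
  by (induction S rule: finite_induct) (auto intro: dfun_const dfun_mult)

definition dfunc :: "((nat \<Rightarrow> real) \<Rightarrow> complex) \<Rightarrow> bool" where
  "dfunc F \<longleftrightarrow> dfun M (\<lambda>e. Re (F e)) \<and> dfun M (\<lambda>e. Im (F e))"

lemma dfunc_const: "dfunc (\<lambda>e. c)"
  by (simp add: dfunc_def dfun_const)

lemma dfunc_of_real: "dfun M F \<Longrightarrow> dfunc (\<lambda>e. of_real (F e))"
  by (simp add: dfunc_def dfun_const)

lemma dfunc_add: "dfunc F \<Longrightarrow> dfunc G \<Longrightarrow> dfunc (\<lambda>e. F e + G e)"
  by (simp add: dfunc_def dfun_add)

lemma dfunc_mult: "dfunc F \<Longrightarrow> dfunc G \<Longrightarrow> dfunc (\<lambda>e. F e * G e)"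
  by (simp add: dfunc_def dfun_add dfun_diff dfun_mult)

lemma dfunc_inverse: "dfunc F \<Longrightarrow> dfunc (\<lambda>e. inverse (F e))"
  by (simp add: dfunc_def dfun_divide dfun_uminus dfun_add dfun_mult power2_eq_square)

lemma dfunc_sum:
  "finite S \<Longrightarrow> (\<And>i. i \<in> S \<Longrightarrow> dfunc (F i)) \<Longrightarrow> dfunc (\<lambda>e. \<Sum>i\<in>S. F i e)"
  by (induction S rule: finite_induct) (auto intro: dfunc_const dfunc_add)

lemma dfunc_prod:
  "finite S \<Longrightarrow> (\<And>i. i \<in> S \<Longrightarrow> dfunc (F i)) \<Longrightarrow> dfunc (\<lambda>e. \<Prod>i\<in>S. F i e)"
  by (induction S rule: finite_induct) (auto intro: dfunc_const dfunc_mult)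

lemma dfunc_power: "dfunc F \<Longrightarrow> dfunc (\<lambda>e. F e ^ n)"
  by (induction n) (auto intro: dfunc_const dfunc_mult)

lemma dfunc_powi: "dfunc F \<Longrightarrow> dfunc (\<lambda>e. F e powi n)"
  by (cases n) (auto simp: power_int_def intro!: dfunc_power dfunc_inverse)

lemma dfun_gbinomial: "dfun M F \<Longrightarrow> dfun M (\<lambda>e. F e gchoose n)"
  unfolding gbinomial_prod_rev by (intro dfun_divide dfun_prod dfun_diff dfun_const) auto

end

lemma dpred_definable:
  assumes "definable M d S"
  shows "dpred M (\<lambda>u. vec d u \<in> S)"
proof -
  obtain \<phi> p where S: "S = {v \<in> carrier_vec d. sat M (\<lambda>i. if i < d then v $ i else p i) \<phi>}"
    using assms unfolding definable_def by blast
  define g where "g i = (if i < d then 2 * i else Suc (2 * i))" for i :: nat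
  have "inj g" unfolding inj_def g_def by presburger
  moreover have "interleave e p \<circ> g = (\<lambda>i. if i < d then vec d e $ i else p i)" for e
    by (auto simp: fun_eq_iff g_def)
  ultimately show ?thesis
    by (intro dpredI[where p = p and \<phi> = "rename_fm g \<phi>"]) (simp add: sat_rename_fm S)
qed

text \<open>Freezing all variables but one turns them into parameters, so o-minimality applies to
  every fibre of a definable predicate, at whatever real values the other variables are
  frozen.\<close>

lemma definable_section:
  assumes "dpred M Q"
  shows "definable M 1 ((\<lambda>a. vec 1 (\<lambda>_. a)) ` {a. Q (e(n := a))})"
proof -
  obtain \<phi> p where \<phi>: "\<And>e. Q e \<longleftrightarrow> sat M (interleave e p) \<phi>"
    using assms unfolding dpred_def by blast
  \<comment> \<open>Variable \<open>n\<close>, stored at index \<open>2 * n\<close>, becomes the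
    only coordinate; all other indices move up into the parameter range.\<close>
  define h where "h i = (if i = 2 * n then 0 else Suc i)" for i :: nat
  have "inj h" unfolding inj_def h_def by presburger
  moreover have "(\<lambda>i. if i < 1 then v $ i else interleave e p (i - 1)) \<circ> h
      = interleave (e(n := v $ 0)) p" for v :: "real vec"
    by (auto simp: fun_eq_iff h_def interleave_def)
  ultimately have *: "sat M (\<lambda>i. if i < 1 then v $ i else interleave e p (i - 1)) (rename_fm h \<phi>)
      \<longleftrightarrow> Q (e(n := v $ 0))" for v
    by (simp add: sat_rename_fm \<phi>)
  have "(\<lambda>a. vec 1 (\<lambda>_. a)) ` {a. Q (e(n := a))} = {v \<in> carrier_vec 1. Q (e(n := v $ 0))}"
  proof (intro equalityI subsetI)
    fix v :: "real vec" assume v: "v \<in> {v \<in> carrier_vec 1. Q (e(n := v $ 0))}"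
    then have "v = vec 1 (\<lambda>_. v $ 0)" by (auto intro!: eq_vecI)
    with v show "v \<in> (\<lambda>a. vec 1 (\<lambda>_. a)) ` {a. Q (e(n := a))}" by blast
  qed auto
  then show ?thesis unfolding definable_def
    by (intro exI[of _ "rename_fm h \<phi>"] exI[of _ "\<lambda>i. interleave e p (i - 1)"]) (simp only: *)
qed

section \<open>Consequences of o-minimality\<close>

lemma is_interval_between:
  "is_interval J \<Longrightarrow> x \<in> J \<Longrightarrow> y \<in> J \<Longrightarrow> x \<le> z \<Longrightarrow> z \<le> y \<Longrightarrow> z \<in> (J :: real set)"
  unfolding is_interval_1 by blast

text \<open>An interval bounded above is eventually left, and an unbounded one contains everything
  beyond any of its points. The threshold is a natural number so that only countably many thresholds
  occur.\<close>

lemma finite_union_intervals_eventually: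
  assumes "finite F" "\<forall>J\<in>F. is_interval (J :: real set)"
  shows "\<exists>m :: nat. (\<forall>s > real m. s \<in> \<Union>F) \<or> (\<forall>s > real m. s \<notin> \<Union>F)"
  using assms
proof (induction F rule: finite_induct)
  case (insert J F)
  obtain m :: nat where m: "(\<forall>s > real m. s \<in> \<Union>F) \<or> (\<forall>s > real m. s \<notin> \<Union>F)"
    using insert by auto
  show ?case
  proof (cases "\<exists>b. \<forall>s\<in>J. s \<le> b")
    case True
    then obtain b where b: "\<And>s. s \<in> J \<Longrightarrow> s \<le> b" by blast
    obtain n :: nat where n: "b \<le> real n" using real_arch_simple[of b] by blast
    have "s \<notin> J" if "s > real (max m n)" for s
      using b[of s] n that by (auto simp: of_nat_max)
    then show ?thesis using m by (intro exI[of _ "max m n"]) (auto simp: of_nat_max)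
  next
    case False
    then obtain a where a: "a \<in> J" by blast
    obtain n :: nat where n: "a \<le> real n" using real_arch_simple[of a] by blast
    have "s \<in> J" if "s > real n" for s
    proof -
      obtain s' where "s' \<in> J" "s' > s" using False by (meson not_le)
      moreover have "a \<le> s" using n that by simp
      moreover have "is_interval J" using insert.prems by simp
      ultimately show ?thesis using a is_interval_between[of J a s' s] by simp
    qed
    then show ?thesis by auto
  qed
qed auto

lemma countable_if_degenerate:
  fixes J :: "real set"
  assumes "\<not> (\<exists>x\<in>J. \<exists>y\<in>J. x < y)"
  shows "countable J"
proof -
  have "x = y" if "x \<in> J" "y \<in> J" for x y
    using assms that linorder_less_linear[of x y] by blast
  then have "J = {} \<or> (\<exists>x. J = {x})" by blast
  then show ?thesis by auto
qed

text \<open>Some interval is nondegenerate, as the interval from \<open>a\<close> to \<open>b\<close> is uncountable.\<close>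

lemma countable_cover_contains_interval:
  fixes S :: "nat \<Rightarrow> real set"
  assumes "a < b" "{a<..<b} \<subseteq> (\<Union>m. S m)"
    and S: "\<And>m. \<exists>F. finite F \<and> (\<forall>J\<in>F. is_interval J) \<and> S m = \<Union>F"
  shows "\<exists>m q q'. a \<le> real_of_rat q \<and> q < q' \<and> real_of_rat q' \<le> b \<and> {of_rat q<..<of_rat q'} \<subseteq> S m"
proof (rule ccontr)
  assume contra: "\<not> ?thesis"
  have "countable ({a<..<b} \<inter> S m)" for m
  proof -
    obtain F where F: "finite F" "\<forall>J\<in>F. is_interval J" "S m = \<Union>F" using S[of m] by blast
    have "countable ({a<..<b} \<inter> J)" if J: "J \<in> F" for J
    proof (rule countable_if_degenerate)
      show "\<not> (\<exists>x\<in>{a<..<b} \<inter> J. \<exists>y\<in>{a<..<b} \<inter> J. x < y)"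
      proof safe
        fix x y assume xy: "x \<in> {a<..<b}" "x \<in> J" "y \<in> {a<..<b}" "y \<in> J" "x < y"
        \<comment> \<open>Rational ends leave only countably many candidate intervals, which keeps
          the cover countable from one dimension to the next.\<close>
        obtain q where q: "x < of_rat q" "of_rat q < y" using of_rat_dense[OF xy(5)] by blast
        obtain q' where q': "of_rat q < (of_rat q' :: real)" "of_rat q' < y"
          using of_rat_dense[OF q(2)] by blast
        have "{of_rat q<..<of_rat q'} \<subseteq> J"
        proof
          fix z assume "z \<in> {of_rat q<..<of_rat q' :: real}"
          then have "x \<le> z" "z \<le> y" using q q' by auto
          then show "z \<in> J" using is_interval_between[of J x y z] xy(2,4) F(2) J by simp
        qed
        then have "{of_rat q<..<of_rat q'} \<subseteq> S m" using F(3) J by blast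
        moreover have "a \<le> of_rat q" "of_rat q' \<le> b" using xy q q' by auto
        moreover have "q < q'" using q' by (simp add: of_rat_less)
        ultimately have "\<exists>m q q'. a \<le> real_of_rat q \<and> q < q' \<and> real_of_rat q' \<le> b
            \<and> {of_rat q<..<of_rat q'} \<subseteq> S m"
          by (intro exI conjI)
        with contra show False by contradiction
      qed
    qed
    then have "countable (\<Union>J\<in>F. {a<..<b} \<inter> J)" using F(1) by (intro countable_UN) (auto intro: countable_finite)
    moreover have "(\<Union>J\<in>F. {a<..<b} \<inter> J) = {a<..<b} \<inter> S m" unfolding F(3) by blast
    ultimately show ?thesis by simp
  qed
  then have "countable (\<Union>m. {a<..<b} \<inter> S m)" by (intro countable_UN) auto
  moreover have "(\<Union>m. {a<..<b} \<inter> S m) = {a<..<b}" using assms(2) by blast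
  ultimately show False using uncountable_open_interval[of a b] assms(1) by simp
qed

locale o_minimal_expansion = exp_expansion +
  assumes o_minimal: "o_minimal M"
begin

lemma section_intervals:
  assumes "dpred M Q"
  shows "\<exists>F. finite F \<and> (\<forall>J\<in>F. is_interval J) \<and> {a. Q (e(n := a))} = \<Union>F"
  using o_minimal[unfolded o_minimal_def, rule_format, OF definable_section[OF assms]] .

lemma eventually_constant:
  assumes "dpred M Q"
  shows "\<exists>m :: nat. (\<forall>s > real m. Q (e(n := s))) \<or> (\<forall>s > real m. \<not> Q (e(n := s)))"
proof -
  obtain F where F: "finite F" "\<forall>J\<in>F. is_interval J" "{a. Q (e(n := a))} = \<Union>F"
    using section_intervals[OF assms, of e n] by blast
  show ?thesis using finite_union_intervals_eventually[OF F(1,2)] unfolding F(3)[symmetric] by simp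
qed

text \<open>With the coordinates from \<open>r\<close> on fixed to 0, projecting a box of dimension
  \<open>r + 1\<close> to one of dimension \<open>r\<close> is the update
  \<open>e(r := 0)\<close>.\<close>

definition box :: "nat \<Rightarrow> (nat \<Rightarrow> real) \<Rightarrow> (nat \<Rightarrow> real) \<Rightarrow> (nat \<Rightarrow> real) set" where
  "box r a b = {e. (\<forall>i<r. a i < e i \<and> e i < b i) \<and> (\<forall>i\<ge>r. e i = 0)}"

text \<open>Every vertical section of the cover contains an interval with
  rational ends by the one-dimensional case, so the predicates \<open>R\<close> cover the projection.\<close>

lemma countable_definable_cover:
  fixes Q :: "nat \<Rightarrow> (nat \<Rightarrow> real) \<Rightarrow> bool"
  assumes "\<And>m. dpred M (Q m)" "\<forall>i<r. a i < b i" "\<And>e. e \<in> box r a b \<Longrightarrow> \<exists>m. Q m e"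
  shows "\<exists>m a' b'. (\<forall>i<r. a i \<le> a' i \<and> a' i < b' i \<and> b' i \<le> b i) \<and> (\<forall>e\<in>box r a' b'. Q m e)"
  using assms
proof (induction r arbitrary: Q)
  case 0
  obtain m where "Q m (\<lambda>_. 0)" using "0"(3)[of "\<lambda>_. 0"] by (auto simp: box_def)
  moreover have "box 0 a b = {\<lambda>_. 0}" by (auto simp: box_def fun_eq_iff)
  ultimately show ?case by (intro exI[of _ m] exI[of _ a] exI[of _ b]) auto
next
  case (Suc r)
  \<comment> \<open>The number \<open>c\<close> codes a threshold index and two rational ends.
    Writing \<open>(e(r := u)) r\<close> instead of \<open>u\<close> matches the shape in which
    \<open>dpred_all_upd\<close> delivers the quantifier.\<close>
  define R where "R c e = (case from_nat c of (m, q, q') \<Rightarrow>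
      a r \<le> of_rat q \<and> q < q' \<and> of_rat q' \<le> b r \<and>
      (\<forall>u. (e(r := u)) r \<le> of_rat q \<or> of_rat q' \<le> (e(r := u)) r \<or> Q m (e(r := u))))"
    for c :: nat and e :: "nat \<Rightarrow> real"
  have R: "dpred M (R c)" for c
  proof -
    obtain m :: nat and q q' :: rat where c: "from_nat c = (m, q, q')" by (metis surj_pair)
    have "dpred M (\<lambda>e. \<not> of_rat q < e r \<or> \<not> e r < of_rat q' \<or> Q m e)"
      by (intro dpred_disj dpred_neg dpred_less dfun_var dfun_const Suc.prems)
    then have "dpred M (\<lambda>e. e r \<le> of_rat q \<or> of_rat q' \<le> e r \<or> Q m e)" by (simp add: not_less)
    from dpred_conj[OF dpred_const[of M "a r \<le> of_rat q \<and> q < q' \<and> of_rat q' \<le> b r"]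
        dpred_all_upd[OF this, of r]]
    show ?thesis by (simp only: R_def[abs_def] c prod.case conj_assoc)
  qed
  have cover_R: "\<exists>c. R c e" if e: "e \<in> box r a b" for e
  proof -
    have cover: "{a r<..<b r} \<subseteq> (\<Union>m. {u. Q m (e(r := u))})"
    proof
      fix u assume "u \<in> {a r<..<b r}"
      then have "e(r := u) \<in> box (Suc r) a b" using e by (auto simp: box_def less_Suc_eq)
      then show "u \<in> (\<Union>m. {u. Q m (e(r := u))})" using Suc.prems(3) by auto
    qed
    have "a r < b r" using Suc.prems(2) by simp
    from countable_cover_contains_interval[OF this cover section_intervals[OF Suc.prems(1), of _ e r]]
    obtain m q q' where "a r \<le> of_rat q" "q < q'" "of_rat q' \<le> b r"
      and sub: "{of_rat q<..<of_rat q'} \<subseteq> {u. Q m (e(r := u))}" by blast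
    moreover have "u \<le> of_rat q \<or> of_rat q' \<le> u \<or> Q m (e(r := u))" for u
      using subsetD[OF sub, of u] by (cases "of_rat q < u"; cases "u < of_rat q'") auto
    ultimately have "R (to_nat (m, q, q')) e" by (simp add: R_def)
    then show ?thesis by blast
  qed
  have "\<forall>i<r. a i < b i" using Suc.prems(2) by simp
  from Suc.IH[of R, OF R this cover_R] obtain c a' b' where
    ab: "\<forall>i<r. a i \<le> a' i \<and> a' i < b' i \<and> b' i \<le> b i" and c: "\<forall>e\<in>box r a' b'. R c e"
    by blast
  obtain m :: nat and q q' :: rat where m: "from_nat c = (m, q, q')" by (metis surj_pair)
  define a'' b'' where "a'' = a'(r := of_rat q)" and "b'' = b'(r := of_rat q')"
  \<comment> \<open>The midpoint witnesses that the box is nonempty; the conditions on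
    \<open>q\<close> and \<open>q'\<close> do not involve \<open>e\<close> and can be read off at
    this point.\<close>
  have "(\<lambda>i. if i < r then (a' i + b' i) / 2 else 0) \<in> box r a' b'"
    using ab by (simp add: box_def)
  with c have "R c (\<lambda>i. if i < r then (a' i + b' i) / 2 else 0)" by blast
  then have q: "a r \<le> of_rat q" "q < q'" "of_rat q' \<le> b r" by (simp_all add: R_def m)
  have "Q m e" if e: "e \<in> box (Suc r) a'' b''" for e
  proof -
    have e': "a'' i < e i \<and> e i < b'' i" if "i < Suc r" for i using e that by (simp add: box_def)
    have "a' i < e i \<and> e i < b' i" if "i < r" for i
      using e'[of i] that by (simp add: a''_def b''_def)
    moreover have "e i = 0" if "i > r" for i using e that by (simp add: box_def)
    ultimately have "e(r := 0) \<in> box r a' b'" by (auto simp: box_def)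
    then have "R c (e(r := 0))" using c by blast
    then have "\<forall>u. u \<le> of_rat q \<or> of_rat q' \<le> u \<or> Q m (e(r := u))" by (simp add: R_def m)
    from spec[OF this, of "e r"] have "e r \<le> of_rat q \<or> of_rat q' \<le> e r \<or> Q m e" by simp
    moreover have "of_rat q < e r" "e r < of_rat q'" using e'[of r] by (simp_all add: a''_def b''_def)
    ultimately show ?thesis by auto
  qed
  moreover have "a i \<le> a'' i \<and> a'' i < b'' i \<and> b'' i \<le> b i" if "i < Suc r" for i
    using ab q that by (auto simp: a''_def b''_def less_Suc_eq of_rat_less)
  ultimately show ?case
    by - (rule exI[of _ m], rule exI[of _ a''], rule exI[of _ b''], blast)
qed

end

section \<open>Integer linear systems\<close>

text \<open>Gaussian elimination: pick \<open>v \<in> G\<close> with \<open>v i \<noteq> 0\<close>, and solve the system with coordinate \<open>i\<close>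
  eliminated. The coordinates \<open>R\<close> are the free ones, and \<open>s j\<close> is \<open>\<beta> j\<close> divided by an integer.\<close>

lemma integer_kernel_basis:
  fixes G :: "('i \<Rightarrow> int) set"
  assumes "finite S"
  shows "\<exists>R w B. finite R \<and> finite B \<and> B \<subseteq> G \<and> R \<subseteq> S \<and>
    (\<forall>v\<in>G. \<forall>j\<in>R. (\<Sum>i\<in>S. v i * w j i) = 0) \<and>
    (\<forall>\<beta> :: 'i \<Rightarrow> real. (\<forall>v\<in>B. (\<Sum>i\<in>S. of_int (v i) * \<beta> i) = 0) \<longrightarrow>
      (\<exists>s. (\<forall>i\<in>S. \<beta> i = (\<Sum>j\<in>R. s j * of_int (w j i))) \<and> (\<forall>j\<in>R. \<bar>s j\<bar> \<le> \<bar>\<beta> j\<bar>)))"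
  using assms
proof (induction "card S" arbitrary: S G)
  case 0
  then show ?case by (intro exI[of _ "{}"]) auto
next
  case (Suc n)
  show ?case
  proof (cases "\<exists>v\<in>G. \<exists>i\<in>S. v i \<noteq> 0")
    \<comment> \<open>All relations vanish on \<open>S\<close>, so nothing is constrained: every
      coordinate is free, with the unit vectors as basis and \<open>s = \<beta>\<close>.\<close>
    case False
    have "\<exists>s. (\<forall>i\<in>S. \<beta> i = (\<Sum>j\<in>S. s j * of_int (if j = i then 1 else 0))) \<and> (\<forall>j\<in>S. \<bar>s j\<bar> \<le> \<bar>\<beta> j\<bar>)"
      for \<beta> :: "'i \<Rightarrow> real"
      using Suc.prems by (intro exI[of _ \<beta>]) (auto simp: if_distrib cong: if_cong)
    then show ?thesis using False Suc.prems
      by (intro exI[of _ S] exI[of _ "\<lambda>j i. if j = i then 1 else 0"] exI[of _ "{}"]) auto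
  next
    case True
    then obtain v i where v: "v \<in> G" "i \<in> S" "v i \<noteq> 0" by blast
    define T where "T = S - {i}"
    have T: "finite T" "n = card T" "i \<notin> T" and S: "S = insert i T"
      using Suc.hyps(2) Suc.prems v(2) by (auto simp: T_def)
    \<comment> \<open>Cross-multiplication cancels coordinate \<open>i\<close> while staying in the
      integers.\<close>
    define elim where "elim u l = v i * u l - u i * v l" for u l
    obtain R w B where R: "finite R" "R \<subseteq> T" and B: "finite B" "B \<subseteq> elim ` G"
      and w: "\<And>u j. u \<in> G \<Longrightarrow> j \<in> R \<Longrightarrow> (\<Sum>l\<in>T. elim u l * w j l) = 0"
      and sol: "\<And>\<beta> :: 'i \<Rightarrow> real. (\<forall>v\<in>B. (\<Sum>i\<in>T. of_int (v i) * \<beta> i) = 0) \<Longrightarrow>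
      (\<exists>s. (\<forall>i\<in>T. \<beta> i = (\<Sum>j\<in>R. s j * of_int (w j i))) \<and> (\<forall>j\<in>R. \<bar>s j\<bar> \<le> \<bar>\<beta> j\<bar>))"
      using Suc.hyps(1)[OF T(2,1), of "elim ` G"] by blast
    \<comment> \<open>The relations in \<open>B\<close> come from finitely many members of
      \<open>G\<close>. Finiteness matters later, where the coefficients of the chosen relations
      must have a common bound.\<close>
    obtain C where C: "C \<subseteq> G" "finite C" "B = elim ` C"
      using B finite_subset_image by metis
    \<comment> \<open>The entry at \<open>i\<close> is forced by the relation \<open>v\<close>;
      scaling the other entries by \<open>v i\<close> keeps it an integer.\<close>
    define w' where "w' j l = (if l = i then - (\<Sum>l\<in>T. v l * w j l) else v i * w j l)" for j l
    have sum_S: "(\<Sum>l\<in>S. f l) = f i + (\<Sum>l\<in>T. f l)" for f :: "'i \<Rightarrow> 'b::comm_monoid_add"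
      unfolding S using T by simp
    have kernel: "(\<Sum>l\<in>S. u l * w' j l) = 0" if "u \<in> G" "j \<in> R" for u j
    proof -
      have "(\<Sum>l\<in>S. u l * w' j l) = u i * (- (\<Sum>l\<in>T. v l * w j l)) + (\<Sum>l\<in>T. u l * (v i * w j l))"
        unfolding sum_S using T(3) by (auto simp: w'_def intro!: sum.cong)
      also have "\<dots> = (\<Sum>l\<in>T. elim u l * w j l)"
        by (simp add: elim_def algebra_simps sum_distrib_left sum_subtractf)
      finally show ?thesis using w[OF that] by simp
    qed
    have solve: "\<exists>s. (\<forall>l\<in>S. \<beta> l = (\<Sum>j\<in>R. s j * of_int (w' j l))) \<and> (\<forall>j\<in>R. \<bar>s j\<bar> \<le> \<bar>\<beta> j\<bar>)"
      if \<beta>: "\<forall>u\<in>insert v C. (\<Sum>l\<in>S. of_int (u l) * \<beta> l) = 0" for \<beta> :: "'i \<Rightarrow> real"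
    proof -
      have eq: "of_int (u i) * \<beta> i = - (\<Sum>l\<in>T. of_int (u l) * \<beta> l)" if "u \<in> insert v C" for u
        using bspec[OF \<beta> that] unfolding sum_S by linarith
      have "(\<Sum>l\<in>T. of_int (elim u l) * \<beta> l) = 0" if "u \<in> C" for u
      proof -
        have "(\<Sum>l\<in>T. of_int (elim u l) * \<beta> l)
            = of_int (v i) * (\<Sum>l\<in>T. of_int (u l) * \<beta> l) - of_int (u i) * (\<Sum>l\<in>T. of_int (v l) * \<beta> l)"
          by (simp add: elim_def algebra_simps sum_distrib_left sum_subtractf)
        also have "\<dots> = 0"
        proof -
          have "(\<Sum>l\<in>T. of_int (u l) * \<beta> l) = - (of_int (u i) * \<beta> i)"
            "(\<Sum>l\<in>T. of_int (v l) * \<beta> l) = - (of_int (v i) * \<beta> i)"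
            using eq[of u] eq[of v] that by simp_all
          then show ?thesis by (simp only:) (simp add: algebra_simps)
        qed
        finally show ?thesis .
      qed
      then obtain s where s: "\<And>l. l \<in> T \<Longrightarrow> \<beta> l = (\<Sum>j\<in>R. s j * of_int (w j l))"
        "\<And>j. j \<in> R \<Longrightarrow> \<bar>s j\<bar> \<le> \<bar>\<beta> j\<bar>"
        using sol[of \<beta>] unfolding C by blast
      define s' where "s' j = s j / of_int (v i)" for j
      have "\<beta> l = (\<Sum>j\<in>R. s' j * of_int (w' j l))" if "l \<in> S" for l
      proof (cases "l = i")
        case False
        then show ?thesis using s(1)[of l] that v(3) unfolding S
          by (auto simp: s'_def w'_def intro!: sum.cong)
      next
        case True
        have "of_int (v i) * \<beta> i = - (\<Sum>l\<in>T. of_int (v l) * (\<Sum>j\<in>R. s j * of_int (w j l)))"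
          using eq[of v] s(1) by simp
        also have "\<dots> = - (\<Sum>j\<in>R. s j * (\<Sum>l\<in>T. of_int (v l) * of_int (w j l)))"
          unfolding sum_distrib_left by (subst sum.swap) (simp add: algebra_simps)
        also have "\<dots> = of_int (v i) * (\<Sum>j\<in>R. s' j * of_int (w' j i))"
          using v(3) by (simp add: w'_def s'_def sum_distrib_left sum_negf)
        finally show ?thesis using v(3) True by simp
      qed
      moreover have "\<bar>s' j\<bar> \<le> \<bar>\<beta> j\<bar>" if "j \<in> R" for j
      proof -
        \<comment> \<open>A nonzero integer has absolute value at least 1, so undoing the scaling by
          \<open>v i\<close> cannot enlarge the solution.\<close>
        have "\<bar>of_int (v i) :: real\<bar> \<ge> 1" using v(3) by linarith
        then have "\<bar>s' j\<bar> \<le> \<bar>s j\<bar>"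
          using mult_left_mono[of 1 "\<bar>of_int (v i)\<bar>" "\<bar>s j\<bar>"] v(3)
          by (simp add: s'_def divide_le_eq)
        then show ?thesis using s(2)[OF that] by linarith
      qed
      ultimately show ?thesis by blast
    qed
    show ?thesis
    proof (intro exI conjI)
      show "finite R" "finite (insert v C)" "insert v C \<subseteq> G" "R \<subseteq> S"
        using R C v(1) S by auto
      show "\<forall>u\<in>G. \<forall>j\<in>R. (\<Sum>l\<in>S. u l * w' j l) = 0" using kernel by blast
      show "\<forall>\<beta> :: 'i \<Rightarrow> real. (\<forall>u\<in>insert v C. (\<Sum>l\<in>S. of_int (u l) * \<beta> l) = 0) \<longrightarrow>
        (\<exists>s. (\<forall>l\<in>S. \<beta> l = (\<Sum>j\<in>R. s j * of_int (w' j l))) \<and> (\<forall>j\<in>R. \<bar>s j\<bar> \<le> \<bar>\<beta> j\<bar>))"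
        using solve by blast
    qed
  qed
qed

section \<open>Density of the orbit of a torus element\<close>

text \<open>For \<open>z \<noteq> 1\<close> the geometric sums stay bounded by
  \<open>2 / norm (z - 1)\<close>. The offset \<open>nmin\<close> serves to find approximations at
  arbitrarily late times.\<close>

lemma mean_powers_tendsto:
  fixes z :: complex
  assumes "norm z = 1"
  shows "(\<lambda>N. (\<Sum>n<N. z ^ (nmin + n)) / of_nat N) \<longlonglongrightarrow> (if z = 1 then 1 else 0)"
proof (cases "z = 1")
  case True
  have "eventually (\<lambda>N. 1 = (\<Sum>n<N. z ^ (nmin + n)) / of_nat N) sequentially"
    using eventually_gt_at_top[of 0] by eventually_elim (simp add: True)
  then have "(\<lambda>N. (\<Sum>n<N. z ^ (nmin + n)) / of_nat N) \<longlonglongrightarrow> 1"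
    by (rule Lim_transform_eventually[OF tendsto_const])
  then show ?thesis using True by simp
next
  case False
  have bound: "norm ((\<Sum>n<N. z ^ (nmin + n)) / of_nat N) \<le> (2 / norm (z - 1)) * (1 / real N)" for N
  proof -
    have "(\<Sum>n<N. z ^ (nmin + n)) = z ^ nmin * ((z ^ N - 1) / (z - 1))"
      using geometric_sum[OF False, of N] by (simp add: power_add sum_distrib_left[symmetric])
    then have "norm (\<Sum>n<N. z ^ (nmin + n)) = norm (z ^ N - 1) / norm (z - 1)"
      using assms by (simp add: norm_mult norm_power norm_divide)
    also have "norm (z ^ N - 1) \<le> 2"
      using norm_triangle_ineq4[of "z ^ N" 1] assms by (simp add: norm_power)
    finally have "norm (\<Sum>n<N. z ^ (nmin + n)) \<le> 2 / norm (z - 1)"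
      by (simp add: divide_right_mono)
    then have "norm (\<Sum>n<N. z ^ (nmin + n)) / real N \<le> 2 / norm (z - 1) / real N"
      by (rule divide_right_mono) simp
    then show ?thesis by (simp add: norm_divide)
  qed
  have "(\<lambda>N. (2 / norm (z - 1)) * (1 / real N)) \<longlonglongrightarrow> 0"
    by (rule tendsto_mult_right_zero) (rule lim_1_over_n)
  from Lim_null_comparison[OF always_eventually[OF allI[OF bound]] this] show ?thesis using False by simp
qed

text \<open>On the unit circle \<open>cnj z\<close> is \<open>1 / z\<close>, hence
  \<open>norm (1 + z) ^ 2\<close> equals \<open>(1 + z) ^ 2 / z\<close>. The kernel peaks at
  \<open>z = 1\<close> and its Fourier coefficients are nonnegative.\<close>

lemma norm_one_plus_power_expand:
  fixes z :: complex
  assumes "norm z = 1"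
  shows "of_real (norm (1 + z) ^ (2 * m)) = (\<Sum>b\<le>2 * m. of_nat ((2 * m) choose b) * z powi (int b - int m))"
proof -
  have z: "z \<noteq> 0" "z * cnj z = 1"
    using assms by (auto simp: complex_norm_square[symmetric])
  have "of_real (norm (1 + z) ^ (2 * m)) = ((1 + z) * cnj (1 + z)) ^ m"
    by (simp only: complex_norm_square[symmetric] power_mult of_real_power)
  also have "(1 + z) * cnj (1 + z) = (1 + z)\<^sup>2 / z"
    using z by (simp add: field_simps power2_eq_square)
  also have "\<dots> ^ m = (z + 1) ^ (2 * m) / z ^ m"
    by (simp add: power_divide power_mult add.commute)
  also have "\<dots> = (\<Sum>b\<le>2 * m. of_nat ((2 * m) choose b) * z ^ b / z ^ m)"
    by (simp add: binomial_ring sum_divide_distrib)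
  also have "\<dots> = (\<Sum>b\<le>2 * m. of_nat ((2 * m) choose b) * z powi (int b - int m))"
    using z(1) by (intro sum.cong refl) (simp add: power_int_diff)
  finally show ?thesis .
qed

text \<open>Writing \<open>q\<close> as \<open>r ^ Suc k\<close> gives each of the \<open>k\<close>
  linear factors its own \<open>r ^ m\<close>, and one more factor is left over.\<close>

lemma polynomial_times_power_less_one:
  fixes q :: real
  assumes "0 \<le> q" "q < 1"
  shows "\<exists>m>0. (2 * real m) ^ k * q ^ m < 1"
proof -
  define r where "r = root (Suc k) q"
  have r: "0 \<le> r" "r < 1" "r ^ Suc k = q"
    using assms real_root_pow_pos2[of "Suc k" q] by (auto simp: r_def simp del: power_Suc)
  have "(\<lambda>m. (2 * (of_nat m * r ^ m)) ^ k * r ^ m) \<longlonglongrightarrow> (2 * 0) ^ k * 0"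
    using r by (intro tendsto_intros powser_times_n_limit_0 LIMSEQ_power_zero) auto
  moreover have "(2 * (of_nat m * r ^ m)) ^ k * r ^ m = (2 * real m) ^ k * q ^ m" for m
  proof -
    have "q ^ m = (r ^ m) ^ k * r ^ m"
      by (simp add: r(3)[symmetric] power_mult_distrib power_mult[symmetric] mult.commute)
    then show ?thesis by (simp add: power_mult_distrib)
  qed
  ultimately have "(\<lambda>m. (2 * real m) ^ k * q ^ m) \<longlonglongrightarrow> 0" by (simp only: mult_zero_right)
  then have "eventually (\<lambda>m. (2 * real m) ^ k * q ^ m < 1) sequentially"
    by (rule order_tendstoD) simp
  then have "eventually (\<lambda>m. 0 < m \<and> (2 * real m) ^ k * q ^ m < 1) sequentially"
    using eventually_gt_at_top[of 0] by eventually_elim simp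
  then obtain m where "0 < m \<and> (2 * real m) ^ k * q ^ m < 1"
    unfolding eventually_sequentially by blast
  then show ?thesis by blast
qed

text \<open>If \<open>lam i ^ n\<close> stays away from \<open>\<alpha>\<close>, then \<open>\<Prod>i. norm (1 + lam i ^ n * cnj (\<alpha> i)) ^ (2 * m)\<close> is
  exponentially (in \<open>m\<close>) smaller than its maximal conceivable value \<open>4 ^ (m * k)\<close>. Its mean over \<open>n\<close>
  only picks up the monomials of the expansion in the relation lattice, on which \<open>\<alpha>\<close> is trivial as
  well; the constant term \<open>(2 * m choose m) ^ k\<close> alone exceeds this bound.\<close>

lemma mean_torus_kernel_lower_bound:
  fixes lam \<alpha> :: "nat \<Rightarrow> complex"
  assumes lam: "\<And>i. i < k \<Longrightarrow> norm (lam i) = 1" and \<alpha>: "\<And>i. i < k \<Longrightarrow> norm (\<alpha> i) = 1"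
    and rel: "\<And>v :: nat \<Rightarrow> int. (\<Prod>i<k. lam i powi v i) = 1 \<Longrightarrow> (\<Prod>i<k. \<alpha> i powi v i) = 1"
    and bound: "\<And>n. n \<ge> nmin \<Longrightarrow> (\<Prod>i<k. norm (1 + lam i ^ n * cnj (\<alpha> i)) ^ (2 * m)) \<le> K"
  shows "real ((2 * m) choose m) ^ k \<le> K"
proof -
  define G where "G = (\<Pi>\<^sub>E i\<in>{..<k}. {..2 * m})"
  define C where "C g = (\<Prod>i<k. (2 * m) choose g i)" for g
  define L where "L g = (\<Prod>i<k. lam i powi (int (g i) - int m))" for g
  define a where "a g = (\<Prod>i<k. cnj (\<alpha> i) powi (int (g i) - int m))" for g
  define f where "f n = (\<Prod>i<k. norm (1 + lam i ^ n * cnj (\<alpha> i)) ^ (2 * m))" for n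
  have "finite G" unfolding G_def by (intro finite_PiE) auto
  have expand: "of_real (f n) = (\<Sum>g\<in>G. of_nat (C g) * a g * L g ^ n)" for n
  proof -
    have "of_real (f n) = (\<Prod>i<k. \<Sum>b\<le>2 * m. of_nat ((2 * m) choose b) * (lam i ^ n * cnj (\<alpha> i)) powi (int b - int m))"
      unfolding f_def of_real_prod using lam \<alpha>
      by (intro prod.cong refl norm_one_plus_power_expand) (simp add: norm_mult norm_power)
    also have "\<dots> = (\<Sum>g\<in>G. \<Prod>i<k. of_nat ((2 * m) choose g i) * (lam i ^ n * cnj (\<alpha> i)) powi (int (g i) - int m))"
      unfolding G_def by (rule prod_sum_PiE) auto
    also have "\<dots> = (\<Sum>g\<in>G. of_nat (C g) * a g * L g ^ n)"
    proof (intro sum.cong refl)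
      fix g
      have "(lam i ^ n) powi c = (lam i powi c) ^ n" for i and c :: int
        by (simp add: power_int_power power_int_power' mult.commute)
      then show "(\<Prod>i<k. of_nat ((2 * m) choose g i) * (lam i ^ n * cnj (\<alpha> i)) powi (int (g i) - int m))
          = of_nat (C g) * a g * L g ^ n"
        by (simp add: C_def a_def L_def prod.distrib power_int_mult_distrib prod_power_distrib)
    qed
    finally show ?thesis .
  qed
  have normL: "norm (L g) = 1" for g
    unfolding L_def prod_norm[symmetric] using lam by (intro prod.neutral) (simp add: norm_power_int)
  \<comment> \<open>The phase \<open>a g\<close> is 1 wherever the mean of \<open>L g ^ n\<close>
    survives. The limit is therefore a sum of nonnegative reals, and any single term bounds it from
    below.\<close>
  have aL: "a g * (if L g = 1 then 1 else 0) = (if L g = 1 then 1 else 0)" for g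
  proof -
    have "a g = 1" if "L g = 1"
    proof -
      have "a g = cnj (\<Prod>i<k. \<alpha> i powi (int (g i) - int m))"
        by (simp add: a_def)
      also have "(\<Prod>i<k. \<alpha> i powi (int (g i) - int m)) = 1"
        using that unfolding L_def by (rule rel)
      finally show ?thesis by simp
    qed
    then show ?thesis by simp
  qed
  define S where "S = (\<Sum>g\<in>G. real (C g) * (if L g = 1 then 1 else 0))"
  have "(\<lambda>N. \<Sum>g\<in>G. of_nat (C g) * a g * ((\<Sum>n<N. L g ^ (nmin + n)) / of_nat N))
      \<longlonglongrightarrow> (\<Sum>g\<in>G. of_nat (C g) * a g * (if L g = 1 then 1 else 0))"
    by (intro tendsto_sum tendsto_mult tendsto_const mean_powers_tendsto normL)
  also have "(\<Sum>g\<in>G. of_nat (C g) * a g * (if L g = 1 then 1 else 0)) = complex_of_real S"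
    by (simp add: S_def mult.assoc aL del: mult_zero_right) (intro sum.cong, auto)
  also have "(\<lambda>N. \<Sum>g\<in>G. of_nat (C g) * a g * ((\<Sum>n<N. L g ^ (nmin + n)) / of_nat N))
      = (\<lambda>N. complex_of_real ((\<Sum>n<N. f (nmin + n)) / real N))"
  proof
    fix N
    have "complex_of_real ((\<Sum>n<N. f (nmin + n)) / real N)
        = (\<Sum>n<N. \<Sum>g\<in>G. of_nat (C g) * a g * L g ^ (nmin + n)) / of_nat N"
      by (simp add: expand)
    also have "\<dots> = (\<Sum>g\<in>G. of_nat (C g) * a g * ((\<Sum>n<N. L g ^ (nmin + n)) / of_nat N))"
      by (subst sum.swap) (simp add: sum_distrib_left sum_divide_distrib)
    finally show "(\<Sum>g\<in>G. of_nat (C g) * a g * ((\<Sum>n<N. L g ^ (nmin + n)) / of_nat N))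
        = complex_of_real ((\<Sum>n<N. f (nmin + n)) / real N)" by simp
  qed
  finally have lim: "(\<lambda>N. (\<Sum>n<N. f (nmin + n)) / real N) \<longlonglongrightarrow> S"
    by (simp only: tendsto_of_real_iff)
  have "eventually (\<lambda>N. (\<Sum>n<N. f (nmin + n)) / real N \<le> K) sequentially"
    using eventually_gt_at_top[of 0]
  proof eventually_elim
    case (elim N)
    have "(\<Sum>n<N. f (nmin + n)) \<le> real (card {..<N}) * K"
      by (rule sum_bounded_above) (simp add: f_def bound)
    then show ?case using elim by (simp add: divide_le_eq mult.commute)
  qed
  with lim have "S \<le> K" by (intro tendsto_upperbound) auto
  moreover have "real ((2 * m) choose m) ^ k \<le> S"
  proof -
    define g0 where "g0 = restrict (\<lambda>_. m) {..<k}"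
    have "g0 \<in> G" "C g0 = ((2 * m) choose m) ^ k" "L g0 = 1"
      by (auto simp: g0_def G_def C_def L_def)
    then have "real ((2 * m) choose m) ^ k = real (C g0) * (if L g0 = 1 then 1 else 0)" by simp
    also have "\<dots> \<le> S" unfolding S_def
      by (rule member_le_sum) (auto simp: \<open>g0 \<in> G\<close> \<open>finite G\<close>)
    finally show ?thesis .
  qed
  ultimately show ?thesis by linarith
qed

text \<open>Kronecker's theorem. If the orbit missed the target from time \<open>nmin\<close> on,
  the mean of the kernel would be at most \<open>4 ^ (m * k) * q ^ m\<close>. Since the central
  binomial coefficient is at least \<open>4 ^ m / (2 * m)\<close>, the lower bound falls short of
  \<open>4 ^ (m * k)\<close> only by a factor polynomial in \<open>m\<close>, which is impossible
  for large \<open>m\<close>.\<close>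

lemma orbit_dense_in_torus:
  fixes lam \<alpha> :: "nat \<Rightarrow> complex"
  assumes lam: "\<And>i. i < k \<Longrightarrow> norm (lam i) = 1" and \<alpha>: "\<And>i. i < k \<Longrightarrow> norm (\<alpha> i) = 1"
    and rel: "\<And>v :: nat \<Rightarrow> int. (\<Prod>i<k. lam i powi v i) = 1 \<Longrightarrow> (\<Prod>i<k. \<alpha> i powi v i) = 1"
    and \<delta>: "\<delta> > 0"
  shows "\<exists>n\<ge>nmin. \<forall>i<k. norm (lam i ^ n - \<alpha> i) < \<delta>"
proof (rule ccontr)
  assume contra: "\<not> ?thesis"
  define \<mu> where "\<mu> n i = lam i ^ n * cnj (\<alpha> i)" for n i
  have \<mu>: "norm (\<mu> n i) = 1" if "i < k" for n i
    using lam \<alpha> that by (simp add: \<mu>_def norm_mult norm_power)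
  have parallelogram: "norm (1 + \<mu> n i) ^ 2 = 4 - norm (\<mu> n i - 1) ^ 2" if "i < k" for n i
  proof -
    have "norm (\<mu> n i) ^ 2 = 1" using \<mu>[OF that] by simp
    then show ?thesis unfolding cmod_power2 by (simp add: power2_eq_square algebra_simps)
  qed
  have \<mu>_far: "norm (\<mu> n i - 1) = norm (lam i ^ n - \<alpha> i)" if "i < k" for n i
  proof -
    have "\<alpha> i * cnj (\<alpha> i) = 1" using \<alpha>[OF that] by (simp add: complex_norm_square[symmetric])
    then have "\<mu> n i - 1 = (lam i ^ n - \<alpha> i) * cnj (\<alpha> i)" by (simp add: \<mu>_def algebra_simps)
    then show ?thesis using \<alpha>[OF that] by (simp add: norm_mult)
  qed
  \<comment> \<open>From \<open>norm (1 + z) ^ 2 = 4 - norm (z - 1) ^ 2\<close> on the unit circle,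
    divided by 4; the maximum with 0 takes care of \<open>\<delta> > 2\<close>.\<close>
  define q where "q = max 0 (1 - \<delta>\<^sup>2 / 4)"
  have q: "0 \<le> q" "q < 1" using \<delta> by (auto simp: q_def)
  obtain m where m: "m > 0" "(2 * real m) ^ k * q ^ m < 1"
    using polynomial_times_power_less_one[OF q] by blast
  have "(\<Prod>i<k. norm (1 + \<mu> n i) ^ (2 * m)) \<le> 4 ^ (m * k) * q ^ m" if n: "n \<ge> nmin" for n
  proof -
    obtain j where j: "j < k" "norm (lam j ^ n - \<alpha> j) \<ge> \<delta>"
      using contra n by (meson not_less)
    have "\<delta>\<^sup>2 \<le> norm (\<mu> n j - 1) ^ 2"
      using j \<delta> \<mu>_far[OF j(1)] by (simp add: power_mono)
    moreover have "1 - \<delta>\<^sup>2 / 4 \<le> q" by (simp add: q_def)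
    ultimately have "norm (1 + \<mu> n j) ^ 2 \<le> 4 * q"
      unfolding parallelogram[OF j(1)] by simp
    then have "norm (1 + \<mu> n j) ^ (2 * m) \<le> (4 * q) ^ m"
      unfolding power_mult by (rule power_mono) simp
    moreover have "(\<Prod>i\<in>{..<k} - {j}. norm (1 + \<mu> n i) ^ (2 * m)) \<le> (\<Prod>i\<in>{..<k} - {j}. 4 ^ m)"
    proof (intro prod_mono conjI)
      fix i assume "i \<in> {..<k} - {j}"
      then have "norm (1 + \<mu> n i) ^ 2 \<le> 4" using parallelogram[of i n] by simp
      then show "norm (1 + \<mu> n i) ^ (2 * m) \<le> 4 ^ m" unfolding power_mult by (rule power_mono) simp
    qed simp
    ultimately have "norm (1 + \<mu> n j) ^ (2 * m) * (\<Prod>i\<in>{..<k} - {j}. norm (1 + \<mu> n i) ^ (2 * m))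
        \<le> (4 * q) ^ m * (4 ^ m) ^ (k - 1)"
      using j(1) q(1) by (intro mult_mono) (auto intro: prod_nonneg)
    also have "\<dots> = (4 ^ m) ^ (Suc (k - 1)) * q ^ m" by (simp add: power_mult_distrib)
    finally show ?thesis using j(1)
      by (subst prod.remove[of _ j]) (auto simp: power_mult[symmetric])
  qed
  then have "real ((2 * m) choose m) ^ k \<le> 4 ^ (m * k) * q ^ m"
    unfolding \<mu>_def using lam \<alpha> rel by (intro mean_torus_kernel_lower_bound[where nmin = nmin and lam = lam and \<alpha> = \<alpha>]) auto
  moreover have "(4 ^ m / (2 * real m)) ^ k \<le> real ((2 * m) choose m) ^ k"
    using central_binomial_lower_bound[OF m(1)] by (intro power_mono) simp_all
  ultimately have "4 ^ (m * k) / (2 * real m) ^ k \<le> 4 ^ (m * k) * q ^ m"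
    by (simp add: power_divide power_mult)
  then show False using m by (simp add: field_simps)
qed

text \<open>Torus elements whose coordinates fall into the same squares of side \<open>1 / M\<close> are within
  \<open>2 / M\<close> of each other, so finitely many of them suffice.\<close>

lemma finite_net:
  fixes T :: "(nat \<Rightarrow> complex) set"
  assumes T: "\<And>\<alpha> i. \<alpha> \<in> T \<Longrightarrow> i < k \<Longrightarrow> norm (\<alpha> i) = 1" and \<delta>: "\<delta> > 0"
  shows "\<exists>F\<subseteq>T. finite F \<and> (\<forall>\<alpha>\<in>T. \<exists>\<beta>\<in>F. \<forall>i<k. norm (\<alpha> i - \<beta> i) < \<delta>)"
proof -
  obtain M :: nat where M: "2 / \<delta> < real M" using reals_Archimedean2 by blast
  have "M > 0" using M \<delta> by (metis divide_pos_pos gr0I less_asym of_nat_0 zero_less_numeral)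
  define cell where "cell \<alpha> = (\<lambda>i\<in>{..<k}. (\<lfloor>real M * Re (\<alpha> i)\<rfloor>, \<lfloor>real M * Im (\<alpha> i)\<rfloor>))"
    for \<alpha> :: "nat \<Rightarrow> complex"
  have floor: "\<lfloor>real M * x\<rfloor> \<in> {- int M..int M}" if "\<bar>x\<bar> \<le> 1" for x
  proof -
    have "\<bar>real M * x\<bar> \<le> real M" using that by (simp add: abs_mult mult_left_le)
    then show ?thesis by (auto simp: le_floor_iff floor_le_iff)
  qed
  have "cell ` T \<subseteq> (\<Pi>\<^sub>E i\<in>{..<k}. {- int M..int M} \<times> {- int M..int M})"
  proof
    fix c assume "c \<in> cell ` T"
    then obtain \<alpha> where \<alpha>: "\<alpha> \<in> T" "c = cell \<alpha>" by blast
    have "\<bar>Re (\<alpha> i)\<bar> \<le> 1" "\<bar>Im (\<alpha> i)\<bar> \<le> 1" if "i < k" for i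
      using T[OF \<alpha>(1) that] abs_Re_le_cmod[of "\<alpha> i"] abs_Im_le_cmod[of "\<alpha> i"] by auto
    then show "c \<in> (\<Pi>\<^sub>E i\<in>{..<k}. {- int M..int M} \<times> {- int M..int M})"
      using floor by (auto simp: \<alpha>(2) cell_def PiE_iff extensional_def simp del: atLeastAtMost_iff)
  qed
  then have "finite (cell ` T)" by (rule finite_subset) (intro finite_PiE, auto)
  then obtain F where F: "F \<subseteq> T" "finite F" "cell ` T = cell ` F"
    using finite_subset_image[of "cell ` T" cell T] by auto
  have "\<forall>\<alpha>\<in>T. \<exists>\<beta>\<in>F. \<forall>i<k. norm (\<alpha> i - \<beta> i) < \<delta>"
  proof
    fix \<alpha> assume "\<alpha> \<in> T"
    then obtain \<beta> where \<beta>: "\<beta> \<in> F" "cell \<alpha> = cell \<beta>" using F(3) by blast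
    have "norm (\<alpha> i - \<beta> i) < \<delta>" if "i < k" for i
    proof -
      have cell_i: "\<lfloor>real M * Re (\<alpha> i)\<rfloor> = \<lfloor>real M * Re (\<beta> i)\<rfloor>" "\<lfloor>real M * Im (\<alpha> i)\<rfloor> = \<lfloor>real M * Im (\<beta> i)\<rfloor>"
        using fun_cong[OF \<beta>(2), of i] that by (auto simp: cell_def)
      have "\<bar>real M * x - real M * y\<bar> < 1" if "\<lfloor>real M * x\<rfloor> = \<lfloor>real M * y\<rfloor>" for x y
        using that by linarith
      from this[OF cell_i(1)] this[OF cell_i(2)]
      have "real M * \<bar>Re (\<alpha> i) - Re (\<beta> i)\<bar> < 1" "real M * \<bar>Im (\<alpha> i) - Im (\<beta> i)\<bar> < 1"
        by (simp_all add: right_diff_distrib[symmetric] abs_mult)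
      then have "\<bar>Re (\<alpha> i) - Re (\<beta> i)\<bar> + \<bar>Im (\<alpha> i) - Im (\<beta> i)\<bar> < 2 / real M"
        using \<open>M > 0\<close> by (simp add: field_simps)
      also have "2 / real M < \<delta>" using M \<delta> \<open>M > 0\<close> by (simp add: field_simps)
      finally show ?thesis using cmod_le[of "\<alpha> i - \<beta> i"] by simp
    qed
    then show "\<exists>\<beta>\<in>F. \<forall>i<k. norm (\<alpha> i - \<beta> i) < \<delta>" using \<beta>(1) by blast
  qed
  then show ?thesis using F by blast
qed

text \<open>Finitely many times serve a net of mesh \<open>\<delta> / 2\<close>, and their maximum
  bounds the waiting time for all elements. This bound makes the final threshold independent of the
  phase.\<close>

lemma uniform_orbit_dense_in_torus:
  fixes lam :: "nat \<Rightarrow> complex" and T :: "(nat \<Rightarrow> complex) set"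
  assumes "\<And>\<alpha> i. \<alpha> \<in> T \<Longrightarrow> i < k \<Longrightarrow> norm (\<alpha> i) = 1"
    and dense: "\<And>\<alpha> \<delta>. \<alpha> \<in> T \<Longrightarrow> \<delta> > 0 \<Longrightarrow> \<exists>n. \<forall>i<k. norm (lam i ^ n - \<alpha> i) < \<delta>"
    and \<delta>: "\<delta> > 0"
  shows "\<exists>N. \<forall>\<alpha>\<in>T. \<exists>n\<le>N. \<forall>i<k. norm (lam i ^ n - \<alpha> i) < \<delta>"
proof -
  obtain F where F: "F \<subseteq> T" "finite F"
    and net: "\<And>\<alpha>. \<alpha> \<in> T \<Longrightarrow> \<exists>\<beta>\<in>F. \<forall>i<k. norm (\<alpha> i - \<beta> i) < \<delta> / 2"
    using finite_net[of T k "\<delta> / 2"] assms(1) \<delta> by auto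
  have "\<forall>\<beta>\<in>F. \<exists>n. \<forall>i<k. norm (lam i ^ n - \<beta> i) < \<delta> / 2"
    using dense[of _ "\<delta> / 2"] F(1) \<delta> by auto
  then obtain n where n: "\<And>\<beta> i. \<beta> \<in> F \<Longrightarrow> i < k \<Longrightarrow> norm (lam i ^ n \<beta> - \<beta> i) < \<delta> / 2"
    by metis
  \<comment> \<open>The inserted 0 keeps \<open>Max\<close> meaningful when the net is
    empty.\<close>
  have "\<exists>n'\<le>Max (insert 0 (n ` F)). \<forall>i<k. norm (lam i ^ n' - \<alpha> i) < \<delta>" if \<alpha>: "\<alpha> \<in> T" for \<alpha>
  proof -
    obtain \<beta> where \<beta>: "\<beta> \<in> F" "\<And>i. i < k \<Longrightarrow> norm (\<alpha> i - \<beta> i) < \<delta> / 2" using net[OF \<alpha>] by blast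
    have "norm (lam i ^ n \<beta> - \<alpha> i) < \<delta>" if "i < k" for i
      using norm_triangle_lt[of "lam i ^ n \<beta> - \<beta> i" "\<beta> i - \<alpha> i" \<delta>] n[OF \<beta>(1) that] \<beta>(2)[OF that]
      by (simp add: norm_minus_commute)
    moreover have "n \<beta> \<le> Max (insert 0 (n ` F))" using \<beta>(1) F(2) by (intro Max_ge) auto
    ultimately show ?thesis by blast
  qed
  then show ?thesis by blast
qed

section \<open>The Jordan form acting on trajectory cones\<close>

lemma block_pos_less_sum:
  assumes "i < k" "j < ds i"
  shows "block_pos ds i j < (\<Sum>l<k. ds l)"
proof -
  have "block_pos ds i j < (\<Sum>l<Suc i. ds l)" using assms by (simp add: block_pos_def)
  also have "\<dots> \<le> (\<Sum>l<k. ds l)" using assms by (intro sum_mono2) auto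
  finally show ?thesis .
qed

lemma bij_betw_block_pos:
  "bij_betw (\<lambda>(i, j). block_pos ds i j) (SIGMA i:{..<k}. {..<ds i}) {..<\<Sum>l<k. ds l}"
proof (rule bij_betw_imageI)
  have less: "block_pos ds i j < block_pos ds i' j'" if "i < i'" "j < ds i" for i j i' j'
    using block_pos_less_sum[of i i' j ds, OF that] by (simp add: block_pos_def)
  have eq: "i = i'" if "block_pos ds i j = block_pos ds i' j'" "j < ds i" "j' < ds i'" for i j i' j'
    using less[of i i' j j'] less[of i' i j' j] that by (metis less_irrefl nat_neq_iff)
  show "inj_on (\<lambda>(i, j). block_pos ds i j) (SIGMA i:{..<k}. {..<ds i})"
  proof (rule inj_onI)
    fix u v assume uv: "u \<in> (SIGMA i:{..<k}. {..<ds i})" "v \<in> (SIGMA i:{..<k}. {..<ds i})"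
      "(case u of (i, j) \<Rightarrow> block_pos ds i j) = (case v of (i, j) \<Rightarrow> block_pos ds i j)"
    obtain i j where [simp]: "u = (i, j)" by (cases u)
    obtain i' j' where [simp]: "v = (i', j')" by (cases v)
    have "i = i'" using eq[of i j i' j'] uv by simp
    then show "u = v" using uv by (simp add: block_pos_def)
  qed
  show "(\<lambda>(i, j). block_pos ds i j) ` (SIGMA i:{..<k}. {..<ds i}) = {..<\<Sum>l<k. ds l}"
  proof (intro equalityI subsetI)
    fix r assume "r \<in> {..<\<Sum>l<k. ds l}"
    then have "\<exists>i<k. \<exists>j<ds i. r = block_pos ds i j"
    proof (induction k)
      case (Suc k)
      show ?case
      proof (cases "r < (\<Sum>l<k. ds l)")
        case True
        then have "\<exists>i<k. \<exists>j<ds i. r = block_pos ds i j" by (intro Suc.IH) simp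
        then obtain i where "i < k" "\<exists>j<ds i. r = block_pos ds i j" by blast
        then show ?thesis by - (rule exI[of _ i], simp)
      next
        case False
        then have "r - (\<Sum>l<k. ds l) < ds k" "r = block_pos ds k (r - (\<Sum>l<k. ds l))"
          using Suc.prems by (simp_all add: block_pos_def)
        then have "\<exists>j<ds k. r = block_pos ds k j" by (intro exI conjI)
        then show ?thesis by - (rule exI[of _ k], simp)
      qed
    qed simp
    then obtain i j where "i < k" "j < ds i" "r = block_pos ds i j" by blast
    then show "r \<in> (\<lambda>(i, j). block_pos ds i j) ` (SIGMA i:{..<k}. {..<ds i})"
      by (intro image_eqI[of _ _ "(i, j)"]) simp_all
  next
    fix r assume "r \<in> (\<lambda>(i, j). block_pos ds i j) ` (SIGMA i:{..<k}. {..<ds i})"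
    then obtain i j where "i < k" "j < ds i" "r = block_pos ds i j" by auto
    then show "r \<in> {..<\<Sum>l<k. ds l}" by (simp add: block_pos_less_sum)
  qed
qed

lemma block_list_Suc:
  "block_list (Suc k) ds \<rho> lam = block_list k ds \<rho> lam @ [(ds k, of_real (\<rho> k) * lam k)]"
  by (simp add: block_list_def)

lemma sum_list_block_list: "sum_list (map fst (block_list k ds \<rho> lam)) = (\<Sum>l<k. ds l)"
  by (induction k) (simp_all add: block_list_Suc, simp add: block_list_def)

text \<open>The block list grows at its end, so induction on the number of blocks has to split off
  the last block.\<close>

lemma jordan_matrix_snoc:
  "jordan_matrix (xs @ [(n, a)]) = (let m = sum_list (map fst xs) in
     four_block_mat (jordan_matrix xs) (0\<^sub>m m n) (0\<^sub>m n m) (jordan_block n a))"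
proof -
  have "dim_row (jordan_matrix xs) = sum_list (map fst xs)" "dim_col (jordan_matrix xs) = sum_list (map fst xs)"
    by simp_all
  then show ?thesis
    unfolding jordan_matrix_def by (simp add: diag_block_mat_last Let_def)
qed

lemma jordan_matrix_index:
  assumes "i < k" "j < ds i" "c < (\<Sum>l<k. ds l)"
  shows "jordan_matrix (block_list k ds \<rho> lam) $$ (block_pos ds i j, c) =
    (if c = block_pos ds i j then of_real (\<rho> i) * lam i
     else if Suc j < ds i \<and> c = block_pos ds i (Suc j) then 1 else 0)"
  using assms
proof (induction k)
  case (Suc k)
  let ?n = "\<Sum>l<k. ds l"
  have entry: "jordan_matrix (block_list (Suc k) ds \<rho> lam) $$ (r, c) =
      (if r < ?n then if c < ?n then jordan_matrix (block_list k ds \<rho> lam) $$ (r, c) else 0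
       else if c < ?n then 0 else jordan_block (ds k) (of_real (\<rho> k) * lam k) $$ (r - ?n, c - ?n))"
    if "r < (\<Sum>l<Suc k. ds l)" for r
    using that Suc.prems(3)
    by (auto simp: block_list_Suc jordan_matrix_snoc sum_list_block_list Let_def)
  have pos: "block_pos ds i j < (\<Sum>l<Suc k. ds l)"
    using Suc.prems by (intro block_pos_less_sum)
  show ?case
  proof (cases "i = k")
    case True
    have "\<not> block_pos ds i j < ?n" "block_pos ds i j - ?n = j" using True by (simp_all add: block_pos_def)
    then show ?thesis unfolding entry[OF pos] using Suc.prems True
      by (auto simp: block_pos_def jordan_block_def)
  next
    case False
    then have i: "i < k" using Suc.prems by simp
    have "block_pos ds i j < ?n" "Suc j < ds i \<Longrightarrow> block_pos ds i (Suc j) < ?n"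
      using i Suc.prems(2) by (simp_all add: block_pos_less_sum)
    then show ?thesis unfolding entry[OF pos] using Suc.IH[OF i Suc.prems(2)] by auto
  qed
qed simp

lemma jordan_matrix_mult_vec_index:
  assumes "i < k" "j < ds i" "y \<in> carrier_vec (\<Sum>l<k. ds l)"
  shows "(jordan_matrix (block_list k ds \<rho> lam) *\<^sub>v y) $ block_pos ds i j =
    of_real (\<rho> i) * lam i * y $ block_pos ds i j
    + (if Suc j < ds i then y $ block_pos ds i (Suc j) else 0)"
proof -
  let ?n = "\<Sum>l<k. ds l" and ?r = "block_pos ds i j" and ?r' = "block_pos ds i (Suc j)"
  have r: "?r < ?n" "Suc j < ds i \<Longrightarrow> ?r' < ?n" using assms by (simp_all add: block_pos_less_sum)
  have Suc_pos: "?r' = Suc ?r" by (simp add: block_pos_def)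
  have "(jordan_matrix (block_list k ds \<rho> lam) *\<^sub>v y) $ ?r
      = (\<Sum>c<?n. jordan_matrix (block_list k ds \<rho> lam) $$ (?r, c) * y $ c)"
    using assms(3) r(1) by (simp add: scalar_prod_def sum_list_block_list atLeast0LessThan)
  also have "\<dots> = (\<Sum>c<?n. (if c = ?r then of_real (\<rho> i) * lam i * y $ ?r else 0)
      + (if c = ?r' then if Suc j < ds i then y $ ?r' else 0 else 0))"
    by (intro sum.cong refl) (auto simp: jordan_matrix_index[where ds = ds, OF assms(1,2)] Suc_pos)
  also have "\<dots> = of_real (\<rho> i) * lam i * y $ ?r + (if Suc j < ds i then y $ ?r' else 0)"
    using r by (simp add: sum.distrib sum.delta')
  finally show ?thesis .
qed

text \<open>Pascal's rule. For a natural number \<open>s\<close>, the vector \<open>Q_poly\<close>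
  is the \<open>s\<close>-th power of the Jordan block applied to its part of \<open>x'\<close>,
  with the \<open>s\<close>-th power of the eigenvalue divided out; the recursion persists for real
  \<open>s\<close>.\<close>

lemma Q_poly_step:
  assumes "j < ds i" "of_real (\<rho> i) * lam i \<noteq> 0"
  shows "of_real (\<rho> i) * lam i * Q_poly ds \<rho> lam x' i j s + Q_poly ds \<rho> lam x' i (Suc j) s
    = of_real (\<rho> i) * lam i * Q_poly ds \<rho> lam x' i j (s + 1)"
proof -
  define \<mu> where "\<mu> = of_real (\<rho> i) * lam i"
  obtain n where n: "ds i - j = Suc n" "ds i - Suc j = n"
    using assms(1) by (metis Suc_diff_Suc)
  define y where "y c = x' $ block_pos ds i (j + c)" for c
  have "\<mu> \<noteq> 0" using assms(2) by (simp only: \<mu>_def not_False_eq_True)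
  have powi: "\<mu> * \<mu> powi (- int (Suc c)) = \<mu> powi (- int c)" for c
    unfolding power_int_minus power_int_of_nat
    using \<open>\<mu> \<noteq> 0\<close> by (simp add: field_simps)
  have shift: "\<mu> * (\<Sum>c<Suc n. of_real (u gchoose c) * \<mu> powi (- int c) * y c)
      = \<mu> * y 0 + (\<Sum>c<n. of_real (u gchoose Suc c) * \<mu> powi (- int c) * y (Suc c))" for u
  proof -
    have comm: "\<mu> * (z * \<mu> powi (- int (Suc c)) * y (Suc c)) = z * (\<mu> * \<mu> powi (- int (Suc c))) * y (Suc c)"
      for z c by (simp only: mult_ac)
    show ?thesis
      unfolding sum.lessThan_Suc_shift distrib_left sum_distrib_left comm powi by simp
  qed
  have "\<mu> * (\<Sum>c<Suc n. of_real (s gchoose c) * \<mu> powi (- int c) * y c)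
      + (\<Sum>c<n. of_real (s gchoose c) * \<mu> powi (- int c) * y (Suc c))
      = \<mu> * (\<Sum>c<Suc n. of_real ((s + 1) gchoose c) * \<mu> powi (- int c) * y c)"
    unfolding shift
    by (simp only: gbinomial_Suc_Suc of_real_add distrib_right sum.distrib) (simp only: add_ac)
  then show ?thesis
    by (simp only: Q_poly_def \<mu>_def[symmetric] n y_def add_Suc add_Suc_right)
qed

text \<open>The empty sum makes the last row of a block, which has no superdiagonal entry, fit the
  general recursion.\<close>

lemma Q_poly_beyond_block: "ds i \<le> j \<Longrightarrow> Q_poly ds \<rho> lam x' i j s = 0"
  by (simp add: Q_poly_def)

lemma Q_poly_0:
  assumes "j < ds i"
  shows "Q_poly ds \<rho> lam x' i j 0 = x' $ block_pos ds i j"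
proof -
  obtain n where "ds i - j = Suc n" using assms by (metis Suc_diff_Suc)
  then show ?thesis by (simp add: Q_poly_def sum.lessThan_Suc_shift del: sum.lessThan_Suc)
qed

text \<open>With \<open>s\<close> the logarithm of \<open>t\<close> to base
  \<open>\<rho> (k - 1)\<close>, the factor \<open>exp (s * ln (\<rho> i))\<close> is the power of
  \<open>t\<close> in the ray. In this form it is visibly definable in \<open>s\<close>, as
  \<open>ln (\<rho> i)\<close> is a constant.\<close>

definition cone_coord ::
  "(nat \<Rightarrow> nat) \<Rightarrow> (nat \<Rightarrow> real) \<Rightarrow> (nat \<Rightarrow> complex) \<Rightarrow> complex vec
     \<Rightarrow> (nat \<Rightarrow> complex) \<Rightarrow> real \<Rightarrow> nat \<Rightarrow> nat \<Rightarrow> complex" where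
  "cone_coord ds \<rho> lam x' p s i j = of_real (exp (s * ln (\<rho> i))) * p i * Q_poly ds \<rho> lam x' i j s"

text \<open>The point of the ray of \<open>p\<close> at \<open>t = \<rho> (k - 1) powr s\<close>.\<close>

definition cone_vec ::
  "nat \<Rightarrow> (nat \<Rightarrow> nat) \<Rightarrow> (nat \<Rightarrow> real) \<Rightarrow> (nat \<Rightarrow> complex) \<Rightarrow> complex vec
     \<Rightarrow> (nat \<Rightarrow> complex) \<Rightarrow> real \<Rightarrow> complex vec" where
  "cone_vec k ds \<rho> lam x' p s = vec (\<Sum>l<k. ds l) (\<lambda>r.
     case inv_into (SIGMA i:{..<k}. {..<ds i}) (\<lambda>(i, j). block_pos ds i j) r of
       (i, j) \<Rightarrow> cone_coord ds \<rho> lam x' p s i j)"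

lemma cone_vec_carrier [simp]: "cone_vec k ds \<rho> lam x' p s \<in> carrier_vec (\<Sum>l<k. ds l)"
  by (simp add: cone_vec_def)

lemma cone_vec_index:
  assumes "i < k" "j < ds i"
  shows "cone_vec k ds \<rho> lam x' p s $ block_pos ds i j = cone_coord ds \<rho> lam x' p s i j"
proof -
  have "inv_into (SIGMA i:{..<k}. {..<ds i}) (\<lambda>(i, j). block_pos ds i j) (block_pos ds i j) = (i, j)"
    using bij_betw_inv_into_left[OF bij_betw_block_pos[of ds k], of "(i, j)"] assms by simp
  then show ?thesis using block_pos_less_sum[of i k j ds, OF assms] by (simp add: cone_vec_def)
qed

lemma vec_eq_blockI:
  assumes "y \<in> carrier_vec (\<Sum>l<k. ds l)" "z \<in> carrier_vec (\<Sum>l<k. ds l)"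
    and "\<And>i j. i < k \<Longrightarrow> j < ds i \<Longrightarrow> y $ block_pos ds i j = z $ block_pos ds i j"
  shows "y = z"
proof (rule eq_vecI)
  fix r assume "r < dim_vec z"
  then have "r \<in> (\<lambda>(i, j). block_pos ds i j) ` (SIGMA i:{..<k}. {..<ds i})"
    using assms(2) bij_betw_imp_surj_on[OF bij_betw_block_pos[of ds k]] by auto
  then show "y $ r = z $ r" using assms(3) by auto
qed (use assms in auto)

lemma jordan_matrix_mult_cone_vec:
  assumes "\<And>i. i < k \<Longrightarrow> \<rho> i > 0" "\<And>i. i < k \<Longrightarrow> cmod (lam i) = 1"
  shows "jordan_matrix (block_list k ds \<rho> lam) *\<^sub>v cone_vec k ds \<rho> lam x' p s
    = cone_vec k ds \<rho> lam x' (\<lambda>i. lam i * p i) (s + 1)"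
proof (rule vec_eq_blockI)
  show "jordan_matrix (block_list k ds \<rho> lam) *\<^sub>v cone_vec k ds \<rho> lam x' p s \<in> carrier_vec (\<Sum>l<k. ds l)"
    using jordan_matrix_carrier[of "block_list k ds \<rho> lam"] cone_vec_carrier
    unfolding sum_list_block_list by (rule mult_mat_vec_carrier)
  fix i j assume ij: "i < k" "j < ds i"
  have "\<rho> i \<noteq> 0" "lam i \<noteq> 0" using assms(1)[OF ij(1)] assms(2)[OF ij(1)] by auto
  then have \<mu>: "of_real (\<rho> i) * lam i \<noteq> 0" by simp
  have "(if Suc j < ds i then cone_vec k ds \<rho> lam x' p s $ block_pos ds i (Suc j) else 0)
      = of_real (exp (s * ln (\<rho> i))) * p i * Q_poly ds \<rho> lam x' i (Suc j) s"
    using ij by (auto simp: cone_vec_index cone_coord_def Q_poly_beyond_block)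
  then have "(jordan_matrix (block_list k ds \<rho> lam) *\<^sub>v cone_vec k ds \<rho> lam x' p s) $ block_pos ds i j
      = of_real (exp (s * ln (\<rho> i))) * p i *
        (of_real (\<rho> i) * lam i * Q_poly ds \<rho> lam x' i j s + Q_poly ds \<rho> lam x' i (Suc j) s)"
    using ij by (simp add: jordan_matrix_mult_vec_index cone_vec_index cone_coord_def algebra_simps)
  also have "\<dots> = of_real (exp ((s + 1) * ln (\<rho> i))) * (lam i * p i) * Q_poly ds \<rho> lam x' i j (s + 1)"
    unfolding Q_poly_step[where i = i and ds = ds and \<rho> = \<rho> and lam = lam, OF ij(2) \<mu>] using assms(1)[OF ij(1)]
    by (simp add: distrib_right exp_add)
  finally show "(jordan_matrix (block_list k ds \<rho> lam) *\<^sub>v cone_vec k ds \<rho> lam x' p s) $ block_pos ds i j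
      = cone_vec k ds \<rho> lam x' (\<lambda>i. lam i * p i) (s + 1) $ block_pos ds i j"
    using ij by (simp add: cone_vec_index cone_coord_def)
qed simp

lemma cone_vec_1_0:
  assumes "x' \<in> carrier_vec (\<Sum>l<k. ds l)"
  shows "cone_vec k ds \<rho> lam x' (\<lambda>_. 1) 0 = x'"
  using assms by (intro vec_eq_blockI) (auto simp: cone_vec_index cone_coord_def Q_poly_0)

lemma ray_subset_cone_vec:
  assumes "y \<in> ray k ds \<rho> lam x' p t0" "t0 \<ge> 1" "\<rho> (k - 1) > 1" "\<And>i. i < k \<Longrightarrow> \<rho> i > 0"
  shows "\<exists>s \<ge> log (\<rho> (k - 1)) t0. y = cone_vec k ds \<rho> lam x' p s"
proof -
  obtain t where y: "y \<in> carrier_vec (\<Sum>i<k. ds i)" and t: "t \<ge> t0"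
    and coord: "\<And>i j. i < k \<Longrightarrow> j < ds i \<Longrightarrow> y $ block_pos ds i j =
          of_real (t powr log (\<rho> (k - 1)) (\<rho> i)) * p i * Q_poly ds \<rho> lam x' i j (log (\<rho> (k - 1)) t)"
    using assms(1) unfolding ray_def by blast
  \<comment> \<open>Both growth factors are the exponential of
    \<open>ln t * ln (\<rho> i) / ln (\<rho> (k - 1))\<close>.\<close>
  have "y = cone_vec k ds \<rho> lam x' p (log (\<rho> (k - 1)) t)"
    using y t assms(2) by (intro vec_eq_blockI)
      (auto simp: coord cone_vec_index cone_coord_def powr_def log_def mult.commute)
  moreover have "log (\<rho> (k - 1)) t0 \<le> log (\<rho> (k - 1)) t" using t assms by simp
  ultimately show ?thesis by blast
qed

section \<open>Rational charts of the torus\<close>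

lemma prod_powi_eq: "u \<noteq> 0 \<Longrightarrow> (\<Prod>i\<in>S. u powi f i) = (u :: 'a::field) powi (\<Sum>i\<in>S. f i)"
  by (induction S rule: infinite_finite_induct) (simp_all add: power_int_add)

lemma prod_powi_distrib: "(\<Prod>i\<in>S. f i) powi n = (\<Prod>i\<in>S. (f i :: 'a::field) powi n)"
  by (induction S rule: infinite_finite_induct) (simp_all add: power_int_mult_distrib)

lemma prod_cis: "(\<Prod>i\<in>S. cis (f i)) = cis (\<Sum>i\<in>S. f i)"
  by (induction S rule: infinite_finite_induct) (simp_all add: cis_mult)

text \<open>Sine and cosine need not be definable, so the circle is parametrised rationally.\<close>

definition cayley :: "real \<Rightarrow> complex" where
  "cayley u = Complex ((1 - u * u) / (1 + u * u)) (2 * u / (1 + u * u))"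

text \<open>The half-angle substitution. Angles may thus be used in proofs about the chart while its
  defining formula stays rational.\<close>

lemma cayley_eq_cis: "cayley u = cis (2 * arctan u)"
proof -
  have pos: "1 + u * u > 0" by (simp add: add_pos_nonneg)
  have "cos (2 * arctan u) = (1 - u * u) / (1 + u * u)" "sin (2 * arctan u) = 2 * u / (1 + u * u)"
    unfolding cos_double sin_double cos_arctan sin_arctan
    using pos by (simp_all add: power_divide power2_eq_square diff_divide_distrib real_sqrt_mult[symmetric])
  then show ?thesis by (simp add: cayley_def complex_eq_iff)
qed

lemma norm_cayley: "norm (cayley u) = 1" and cayley_nonzero: "cayley u \<noteq> 0"
  by (simp_all add: cayley_eq_cis)

lemma cayley_rotate:
  assumes "a < u0" "u0 < b"
  shows "\<exists>\<eta>>0. \<forall>h. \<bar>h\<bar> < \<eta> \<longrightarrow> (\<exists>u. a < u \<and> u < b \<and> cayley u = cayley u0 * cis h)"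
proof -
  \<comment> \<open>Rotating by \<open>h\<close> adds \<open>h / 2\<close> to the arctangent; as
    long as the sum stays between \<open>- (pi / 2)\<close> and \<open>pi / 2\<close>, the tangent
    recovers a parameter.\<close>
  define f where "f h = arctan u0 + h / 2" for h
  have f0: "f 0 = arctan u0" by (simp add: f_def)
  have tan_cont: "isCont (\<lambda>h. tan (f h)) 0" unfolding f_def by (intro continuous_intros) simp_all
  have f_cont: "isCont f 0" unfolding f_def by (intro continuous_intros) simp_all
  have "((\<lambda>h. tan (f h)) \<longlongrightarrow> tan (f 0)) (nhds 0)"
    using tan_cont[unfolded isCont_def] by (rule tendsto_at_iff_tendsto_nhds[of "\<lambda>h. tan (f h)" 0, THEN iffD1])
  moreover have "(f \<longlongrightarrow> f 0) (nhds 0)"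
    using f_cont[unfolded isCont_def] by (rule tendsto_at_iff_tendsto_nhds[of f 0, THEN iffD1])
  ultimately have tan: "((\<lambda>h. tan (f h)) \<longlongrightarrow> u0) (nhds 0)" and f: "(f \<longlongrightarrow> arctan u0) (nhds 0)"
    by (simp_all only: f0 tan_arctan)
  have "- (pi / 2) < arctan u0" "arctan u0 < pi / 2" using arctan_bounded[of u0] by simp_all
  from order_tendstoD(1)[OF tan assms(1)] order_tendstoD(2)[OF tan assms(2)]
    order_tendstoD(1)[OF f this(1)] order_tendstoD(2)[OF f this(2)]
  have "eventually (\<lambda>h. a < tan (f h) \<and> tan (f h) < b \<and> - (pi / 2) < f h \<and> f h < pi / 2) (nhds 0)"
    by eventually_elim simp
  then obtain \<eta> where "\<eta> > 0"
    "\<forall>h. dist h 0 < \<eta> \<longrightarrow> a < tan (f h) \<and> tan (f h) < b \<and> - (pi / 2) < f h \<and> f h < pi / 2"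
    unfolding eventually_nhds_metric by blast
  then have \<eta>: "\<eta> > 0"
    "\<And>h. \<bar>h\<bar> < \<eta> \<Longrightarrow> a < tan (f h) \<and> tan (f h) < b \<and> - (pi / 2) < f h \<and> f h < pi / 2"
    by (simp_all add: dist_real_def)
  have "cayley (tan (f h)) = cayley u0 * cis h" if "\<bar>h\<bar> < \<eta>" for h
    using \<eta>(2)[OF that] by (simp add: cayley_eq_cis arctan_tan cis_mult f_def)
  then have "\<bar>h\<bar> < \<eta> \<Longrightarrow> a < tan (f h) \<and> tan (f h) < b \<and> cayley (tan (f h)) = cayley u0 * cis h" for h
    using \<eta>(2)[of h] by blast
  then show ?thesis using \<eta>(1) by blast
qed

lemma small_argument:
  fixes \<eta> :: real
  assumes "\<eta> > 0"
  shows "\<exists>\<delta>>0. \<forall>z. norm z = 1 \<longrightarrow> norm (z - 1) < \<delta> \<longrightarrow> (\<exists>\<beta>. \<bar>\<beta>\<bar> < \<eta> \<and> z = cis \<beta>)"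
proof -
  have "isCont arcsin 0" by (rule isCont_arcsin) simp_all
  then obtain \<delta> where \<delta>: "\<delta> > 0" "\<And>y. \<bar>y\<bar> < \<delta> \<Longrightarrow> \<bar>arcsin y\<bar> < \<eta>"
    using assms unfolding continuous_at_eps_delta dist_real_def by (metis arcsin_0 diff_zero)
  \<comment> \<open>The cut-off at 1 forces \<open>Re z > 0\<close>, the half circle on which
    \<open>arcsin (Im z)\<close> is the argument.\<close>
  have "\<exists>\<beta>. \<bar>\<beta>\<bar> < \<eta> \<and> z = cis \<beta>" if z: "norm z = 1" "norm (z - 1) < min \<delta> 1" for z
  proof (intro exI conjI)
    have "\<bar>Im z\<bar> < \<delta>" "\<bar>Re z - 1\<bar> < 1"
      using abs_Im_le_cmod[of "z - 1"] abs_Re_le_cmod[of "z - 1"] z(2) by simp_all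
    then show "\<bar>arcsin (Im z)\<bar> < \<eta>" using \<delta> by blast
    have "(Re z)\<^sup>2 + (Im z)\<^sup>2 = 1" using z(1) cmod_power2[of z] by simp
    then have "sqrt (1 - (Im z)\<^sup>2) = \<bar>Re z\<bar>" by (metis add_diff_cancel_right' real_sqrt_abs)
    moreover have "Re z > 0" using \<open>\<bar>Re z - 1\<bar> < 1\<close> by linarith
    moreover have "- 1 \<le> Im z" "Im z \<le> 1" using abs_Im_le_cmod[of z] z(1) by simp_all
    ultimately show "z = cis (arcsin (Im z))" by (simp add: complex_eq_iff cos_arcsin)
  qed
  then show ?thesis using \<delta>(1) by (intro exI[of _ "min \<delta> 1"]) simp
qed

text \<open>Each integer vector \<open>w j\<close> in the kernel of the relations gives a circle
  subgroup of the torus, with \<open>w j i\<close> as exponents; the chart multiplies one point from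
  each. It may miss other components of the torus, which the powers of \<open>lam\<close>
  reach.\<close>

definition torus_chart :: "nat set \<Rightarrow> (nat \<Rightarrow> nat \<Rightarrow> int) \<Rightarrow> (nat \<Rightarrow> real) \<Rightarrow> nat \<Rightarrow> complex" where
  "torus_chart R w e i = (\<Prod>j\<in>R. cayley (e j) powi w j i)"

lemma norm_torus_chart: "norm (torus_chart R w e i) = 1"
  unfolding torus_chart_def prod_norm[symmetric] by (simp add: norm_power_int norm_cayley)

lemma torus_chart_in_torus:
  assumes "\<forall>v\<in>mult_relations k lam. \<forall>j\<in>R. (\<Sum>i<k. v i * w j i) = 0"
  shows "torus_chart R w e \<in> torus k lam"
proof -
  have "(\<Prod>i<k. torus_chart R w e i powi v i) = 1" if v: "v \<in> mult_relations k lam" for v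
  proof -
    have "(\<Prod>i<k. torus_chart R w e i powi v i) = (\<Prod>j\<in>R. \<Prod>i<k. cayley (e j) powi (v i * w j i))"
      unfolding torus_chart_def prod_powi_distrib
      by (subst prod.swap) (simp add: power_int_mult[symmetric] mult.commute)
    also have "\<dots> = (\<Prod>j\<in>R. cayley (e j) powi (\<Sum>i<k. v i * w j i))"
      by (simp only: prod_powi_eq[OF cayley_nonzero])
    also have "\<dots> = 1" using assms v by (intro prod.neutral) simp
    finally show ?thesis .
  qed
  then show ?thesis by (simp add: torus_def norm_torus_chart)
qed

text \<open>Close to the base point, a relation \<open>v \<in> B\<close> between the coordinates lifts to a linear
  equation between their arguments, as the arguments cannot wrap around.\<close>

lemma torus_chart_open:
  assumes R: "R \<subseteq> {..<k}" and B: "finite B" "B \<subseteq> mult_relations k lam"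
    and kernel: "\<forall>v\<in>mult_relations k lam. \<forall>j\<in>R. (\<Sum>i<k. v i * w j i) = 0"
    and solve: "\<And>\<beta> :: nat \<Rightarrow> real. \<forall>v\<in>B. (\<Sum>i<k. of_int (v i) * \<beta> i) = 0 \<Longrightarrow>
      \<exists>s. (\<forall>i<k. \<beta> i = (\<Sum>j\<in>R. s j * of_int (w j i))) \<and> (\<forall>j\<in>R. \<bar>s j\<bar> \<le> \<bar>\<beta> j\<bar>)"
    and e0: "\<forall>i<k. a i < e0 i \<and> e0 i < b i"
  shows "\<exists>\<delta>>0. \<forall>\<alpha>\<in>torus k lam. (\<forall>i<k. norm (\<alpha> i - torus_chart R w e0 i) < \<delta>) \<longrightarrow>
    (\<exists>e. (\<forall>i<k. a i < e i \<and> e i < b i) \<and> (\<forall>i\<ge>k. e i = 0) \<and> (\<forall>i<k. \<alpha> i = torus_chart R w e i))"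
proof -
  let ?c = "torus_chart R w e0"
  have "finite R" using R by (rule finite_subset) simp
  have "\<forall>j\<in>R. \<exists>\<eta>>0. \<forall>h. \<bar>h\<bar> < \<eta> \<longrightarrow> (\<exists>u. a j < u \<and> u < b j \<and> cayley u = cayley (e0 j) * cis h)"
  proof
    fix j assume "j \<in> R"
    then have "j < k" using R by blast
    then show "\<exists>\<eta>>0. \<forall>h. \<bar>h\<bar> < \<eta> \<longrightarrow> (\<exists>u. a j < u \<and> u < b j \<and> cayley u = cayley (e0 j) * cis h)"
      using e0 cayley_rotate[of "a j" "e0 j" "b j"] by simp
  qed
  then obtain \<eta> where "\<forall>j\<in>R. \<eta> j > 0 \<and>
      (\<forall>h. \<bar>h\<bar> < \<eta> j \<longrightarrow> (\<exists>u. a j < u \<and> u < b j \<and> cayley u = cayley (e0 j) * cis h))"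
    by (rule bchoice[THEN exE])
  then have \<eta>: "\<And>j. j \<in> R \<Longrightarrow> \<eta> j > 0"
    and rotate: "\<And>j h. j \<in> R \<Longrightarrow> \<bar>h\<bar> < \<eta> j \<Longrightarrow> \<exists>u. a j < u \<and> u < b j \<and> cayley u = cayley (e0 j) * cis h"
    by simp_all
  \<comment> \<open>\<open>W\<close> bounds the coefficient sum of every relation in
    \<open>B\<close>, so arguments below \<open>1 / (1 + W)\<close> combine to at most 1, less than
    \<open>pi\<close>. The bounds \<open>\<eta> j\<close> entering \<open>\<theta>\<close> keep the
    solved parameters inside the box.\<close>
  define W where "W = (\<Sum>v\<in>B. \<Sum>i<k. \<bar>real_of_int (v i)\<bar>)"
  have "W \<ge> 0" unfolding W_def by (intro sum_nonneg) simp
  define \<theta> where "\<theta> = Min (insert (1 / (1 + W)) (\<eta> ` R))"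
  have \<theta>: "\<theta> > 0" "\<theta> \<le> 1 / (1 + W)" "\<And>j. j \<in> R \<Longrightarrow> \<theta> \<le> \<eta> j"
    using \<open>finite R\<close> \<eta> \<open>W \<ge> 0\<close> by (auto simp: \<theta>_def)
  obtain \<delta> where \<delta>: "\<delta> > 0"
    and arg: "\<And>z. norm z = 1 \<Longrightarrow> norm (z - 1) < \<delta> \<Longrightarrow> \<exists>\<beta>. \<bar>\<beta>\<bar> < \<theta> \<and> z = cis \<beta>"
    using small_argument[OF \<theta>(1)] by blast
  have c: "?c \<in> torus k lam" using kernel by (rule torus_chart_in_torus)
  have c_nz: "?c i \<noteq> 0" for i
  proof
    assume "?c i = 0"
    then have "norm (?c i) = 0" by simp
    then show False by (simp add: norm_torus_chart)
  qed
  have "\<exists>e. (\<forall>i<k. a i < e i \<and> e i < b i) \<and> (\<forall>i\<ge>k. e i = 0) \<and> (\<forall>i<k. \<alpha> i = torus_chart R w e i)"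
    if \<alpha>: "\<alpha> \<in> torus k lam" and near: "\<forall>i<k. norm (\<alpha> i - ?c i) < \<delta>" for \<alpha>
  proof -
    have "\<forall>i. \<exists>\<beta>. i < k \<longrightarrow> \<bar>\<beta>\<bar> < \<theta> \<and> \<alpha> i / ?c i = cis \<beta>"
    proof
      fix i
      have "\<exists>\<beta>. \<bar>\<beta>\<bar> < \<theta> \<and> \<alpha> i / ?c i = cis \<beta>" if i: "i < k"
      proof (rule arg)
        show "norm (\<alpha> i / ?c i) = 1" using \<alpha> i by (simp add: torus_def norm_divide norm_torus_chart)
        have "\<alpha> i / ?c i - 1 = (\<alpha> i - ?c i) / ?c i" using c_nz[of i] by (simp add: diff_divide_distrib)
        then show "norm (\<alpha> i / ?c i - 1) < \<delta>" using near i by (simp add: norm_divide norm_torus_chart)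
      qed
      then show "\<exists>\<beta>. i < k \<longrightarrow> \<bar>\<beta>\<bar> < \<theta> \<and> \<alpha> i / ?c i = cis \<beta>" by blast
    qed
    then obtain \<beta> where "\<forall>i. i < k \<longrightarrow> \<bar>\<beta> i\<bar> < \<theta> \<and> \<alpha> i / ?c i = cis (\<beta> i)"
      by (rule choice[THEN exE])
    then have "\<bar>\<beta> i\<bar> < \<theta>" and div: "\<alpha> i / ?c i = cis (\<beta> i)" if "i < k" for i
      using that by simp_all
    moreover have "\<alpha> i = ?c i * cis (\<beta> i)" if "i < k" for i
      using div[OF that] c_nz[of i] by (simp add: divide_eq_eq mult.commute)
    ultimately have \<beta>: "\<And>i. i < k \<Longrightarrow> \<bar>\<beta> i\<bar> < \<theta>" "\<And>i. i < k \<Longrightarrow> \<alpha> i = ?c i * cis (\<beta> i)"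
      by simp_all
    have "(\<Sum>i<k. of_int (v i) * \<beta> i) = 0" if v: "v \<in> B" for v
    proof -
      have rel: "v \<in> mult_relations k lam" using v B by blast
      have "(\<Prod>i<k. \<alpha> i powi v i) = (\<Prod>i<k. ?c i powi v i) * cis (\<Sum>i<k. of_int (v i) * \<beta> i)"
      proof -
        have "(\<Prod>i<k. \<alpha> i powi v i) = (\<Prod>i<k. ?c i powi v i * cis (of_int (v i) * \<beta> i))"
          by (intro prod.cong refl) (simp add: \<beta>(2) power_int_mult_distrib cis_power_int)
        then show ?thesis by (simp add: prod.distrib prod_cis)
      qed
      moreover have "(\<Prod>i<k. \<alpha> i powi v i) = 1" "(\<Prod>i<k. ?c i powi v i) = 1"
        using \<alpha> c rel unfolding torus_def by blast+
      ultimately have "cis (\<Sum>i<k. of_int (v i) * \<beta> i) = 1" by simp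
      then have "Im (cis (\<Sum>i<k. of_int (v i) * \<beta> i)) = Im 1" by (rule arg_cong)
      then have "sin (\<Sum>i<k. of_int (v i) * \<beta> i) = 0" by simp
      moreover have "\<bar>\<Sum>i<k. of_int (v i) * \<beta> i\<bar> < pi"
      proof -
        have "\<bar>\<Sum>i<k. of_int (v i) * \<beta> i\<bar> \<le> (\<Sum>i<k. \<bar>of_int (v i) * \<beta> i\<bar>)" by (rule sum_abs)
        also have "\<dots> \<le> (\<Sum>i<k. \<bar>of_int (v i)\<bar> * \<theta>)"
        proof (rule sum_mono)
          fix i assume "i \<in> {..<k}"
          then have "\<bar>\<beta> i\<bar> \<le> \<theta>" using \<beta>(1)[of i] by simp
          then show "\<bar>of_int (v i) * \<beta> i\<bar> \<le> \<bar>of_int (v i)\<bar> * \<theta>"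
            unfolding abs_mult by (rule mult_left_mono) simp
        qed
        also have "\<dots> = (\<Sum>i<k. \<bar>real_of_int (v i)\<bar>) * \<theta>" by (simp add: sum_distrib_right)
        also have "\<dots> \<le> W * \<theta>"
        proof (rule mult_right_mono)
          show "(\<Sum>i<k. \<bar>real_of_int (v i)\<bar>) \<le> W"
            unfolding W_def by (rule member_le_sum[OF v _ B(1)]) (simp add: sum_nonneg)
        qed (use \<theta>(1) in simp)
        also have "\<dots> \<le> W * (1 / (1 + W))" using \<theta>(2) \<open>W \<ge> 0\<close> by (rule mult_left_mono)
        also have "\<dots> \<le> 1" using \<open>W \<ge> 0\<close> by simp
        also have "1 < pi" using pi_ge_two by simp
        finally show ?thesis .
      qed
      ultimately show ?thesis by - (rule sin_eq_0_pi, auto)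
    qed
    then obtain s where s: "\<And>i. i < k \<Longrightarrow> \<beta> i = (\<Sum>j\<in>R. s j * of_int (w j i))" "\<And>j. j \<in> R \<Longrightarrow> \<bar>s j\<bar> \<le> \<bar>\<beta> j\<bar>"
      using solve[of \<beta>] by blast
    have "\<exists>u. a j < u \<and> u < b j \<and> cayley u = cayley (e0 j) * cis (s j)" if j: "j \<in> R" for j
    proof (rule rotate[OF j])
      have "j < k" using R j by blast
      then show "\<bar>s j\<bar> < \<eta> j" using s(2)[OF j] \<beta>(1)[of j] \<theta>(3)[OF j] by linarith
    qed
    then have "\<forall>j\<in>R. \<exists>u. a j < u \<and> u < b j \<and> cayley u = cayley (e0 j) * cis (s j)" by blast
    then obtain u where "\<forall>j\<in>R. a j < u j \<and> u j < b j \<and> cayley (u j) = cayley (e0 j) * cis (s j)"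
      by (rule bchoice[THEN exE])
    then have u: "\<And>j. j \<in> R \<Longrightarrow> a j < u j \<and> u j < b j \<and> cayley (u j) = cayley (e0 j) * cis (s j)"
      by blast
    \<comment> \<open>The chart reads only the coordinates in \<open>R\<close>; the others keep the
      value of \<open>e0\<close> so that the point remains in the box.\<close>
    define e where "e j = (if j \<in> R then u j else if j < k then e0 j else 0)" for j
    have "\<alpha> i = torus_chart R w e i" if i: "i < k" for i
    proof -
      have "torus_chart R w e i = (\<Prod>j\<in>R. cayley (e0 j) powi w j i * cis (s j * of_int (w j i)))"
        unfolding torus_chart_def
        by (intro prod.cong refl) (simp add: e_def u power_int_mult_distrib cis_power_int mult.commute)
      also have "\<dots> = ?c i * cis (\<beta> i)"
        by (simp add: prod.distrib prod_cis torus_chart_def s(1)[OF i])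
      finally show ?thesis using \<beta>(2)[OF i] by simp
    qed
    moreover have "\<forall>i<k. a i < e i \<and> e i < b i" using e0 u by (simp add: e_def)
    moreover have "\<forall>i\<ge>k. e i = 0" using R by (auto simp: e_def)
    ultimately show ?thesis by blast
  qed
  then show ?thesis using \<delta> by blast
qed

section \<open>Trajectory cones inside invariants\<close>

lemma torus_mult:
  assumes "\<alpha> \<in> torus k lam" "\<beta> \<in> torus k lam"
  shows "(\<lambda>i. \<alpha> i * \<beta> i) \<in> torus k lam"
  using assms by (simp add: torus_def norm_mult power_int_mult_distrib prod.distrib)

lemma torus_cnj:
  assumes "\<alpha> \<in> torus k lam"
  shows "(\<lambda>i. cnj (\<alpha> i)) \<in> torus k lam"
proof -
  have "(\<Prod>i<k. cnj (\<alpha> i) powi v i) = cnj (\<Prod>i<k. \<alpha> i powi v i)" for v by simp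
  then show ?thesis using assms by (simp add: torus_def del: cnj_prod)
qed

lemma torus_power:
  assumes "\<And>i. i < k \<Longrightarrow> cmod (lam i) = 1"
  shows "(\<lambda>i. lam i ^ n) \<in> torus k lam"
proof (induction n)
  case (Suc n)
  have "lam \<in> torus k lam" using assms by (simp add: torus_def mult_relations_def)
  from torus_mult[OF this Suc] show ?case by simp
qed (simp add: torus_def)

lemma cone_vec_cong:
  assumes "\<And>i. i < k \<Longrightarrow> p i = q i"
  shows "cone_vec k ds \<rho> lam x' p s = cone_vec k ds \<rho> lam x' q s"
  by (rule vec_eq_blockI[where ds = ds and k = k]) (simp_all add: cone_vec_index cone_coord_def assms)

lemma torus_chart_cong:
  assumes "\<And>j. j \<in> R \<Longrightarrow> e j = e' j"
  shows "torus_chart R w e = torus_chart R w e'"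
  unfolding torus_chart_def fun_eq_iff using assms by (intro allI prod.cong) simp_all

lemma complex_of_real_of_rat: "complex_of_real (real_of_rat q) = of_rat q"
  by (cases q) (simp add: of_rat_rat)

lemma map_vec_of_real_mult_mat_vec:
  assumes "B \<in> carrier_mat n n" "v \<in> carrier_vec n"
  shows "map_vec complex_of_real (B *\<^sub>v v) = map_mat complex_of_real B *\<^sub>v map_vec complex_of_real v"
  using assms by (intro eq_vecI) (simp_all add: scalar_prod_def)

context exp_expansion
begin

lemma dfunc_cayley: "dfunc (\<lambda>e. cayley (e j))"
  unfolding dfunc_def cayley_def complex.sel
  by (intro conjI dfun_divide dfun_mult dfun_add dfun_diff dfun_const dfun_var)

lemma dfunc_torus_chart: "finite R \<Longrightarrow> dfunc (\<lambda>e. torus_chart R w e i)"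
  unfolding torus_chart_def by (intro dfunc_prod dfunc_powi dfunc_cayley)

lemma dfunc_cone_vec:
  assumes p: "\<And>i. i < k \<Longrightarrow> dfunc (\<lambda>e. p e i)" and c: "c < (\<Sum>l<k. ds l)"
  shows "dfunc (\<lambda>e. cone_vec k ds \<rho> lam x' (p e) (e n) $ c)"
proof -
  have "c \<in> (\<lambda>(i, j). block_pos ds i j) ` (SIGMA i:{..<k}. {..<ds i})"
    using c bij_betw_imp_surj_on[OF bij_betw_block_pos[of ds k]] by simp
  then obtain i j where ij: "c = block_pos ds i j" "i < k" "j < ds i" by auto
  have "dfunc (\<lambda>e. cone_coord ds \<rho> lam x' (p e) (e n) i j)"
    unfolding cone_coord_def Q_poly_def
    by (intro dfunc_mult dfunc_sum dfunc_of_real dfun_exp dfun_mult dfun_gbinomial dfun_var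
        dfun_const dfunc_const p ij(2) finite_lessThan)
  then show ?thesis by (simp add: ij cone_vec_index)
qed

text \<open>Points of a ray are complex a priori; membership splits into vanishing imaginary parts
  and membership of the vector of real parts, both of which are definable.\<close>

lemma dpred_complex_mem:
  fixes F :: "(nat \<Rightarrow> real) \<Rightarrow> complex Matrix.vec"
  assumes "definable M d I" "I \<subseteq> carrier_vec d"
    and F: "\<And>l. l < d \<Longrightarrow> dfunc (\<lambda>e. F e $ l)" "\<And>e. F e \<in> carrier_vec d"
  shows "dpred M (\<lambda>e. F e \<in> map_vec complex_of_real ` I)"
proof -
  have mem: "F e \<in> map_vec complex_of_real ` I \<longleftrightarrow>
      (\<forall>l<d. Im (F e $ l) = 0) \<and> vec d (\<lambda>l. Re (F e $ l)) \<in> I" for e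
  proof
    assume "F e \<in> map_vec complex_of_real ` I"
    then obtain v where v: "v \<in> I" "F e = map_vec complex_of_real v" by blast
    then have "v \<in> carrier_vec d" using assms(2) by blast
    then have "vec d (\<lambda>l. Re (F e $ l)) = v" using v(2) by (intro eq_vecI) auto
    then show "(\<forall>l<d. Im (F e $ l) = 0) \<and> vec d (\<lambda>l. Re (F e $ l)) \<in> I"
      using v \<open>v \<in> carrier_vec d\<close> by simp
  next
    assume *: "(\<forall>l<d. Im (F e $ l) = 0) \<and> vec d (\<lambda>l. Re (F e $ l)) \<in> I"
    then have "F e = map_vec complex_of_real (vec d (\<lambda>l. Re (F e $ l)))"
      using F(2)[of e] by (intro eq_vecI) (auto simp: complex_eq_iff)
    then show "F e \<in> map_vec complex_of_real ` I" using * by blast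
  qed
  have "dpred M (\<lambda>e. vec d (\<lambda>i. if i < d then Re (F e $ i) else e (i - d)) \<in> I)"
    by (rule dpred_subst_many[OF dpred_definable[OF assms(1)], of d "\<lambda>i e. Re (F e $ i)"])
      (use F(1) in \<open>simp add: dfunc_def\<close>)
  moreover have "vec d (\<lambda>i. if i < d then Re (F e $ i) else e (i - d)) = vec d (\<lambda>i. Re (F e $ i))" for e
    by (intro eq_vecI) auto
  ultimately have "dpred M (\<lambda>e. vec d (\<lambda>i. Re (F e $ i)) \<in> I)" by simp
  moreover have "dpred M (\<lambda>e. \<forall>l<d. Im (F e $ l) = 0)"
    using F(1) by (intro dpred_all_less dpred_eq dfun_const) (simp add: dfunc_def)
  ultimately show ?thesis unfolding mem by (intro dpred_conj)
qed

lemma dpred_mult_mat_vec_mem: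
  fixes F :: "(nat \<Rightarrow> real) \<Rightarrow> complex Matrix.vec"
  assumes "definable M d I" "I \<subseteq> carrier_vec d" "P \<in> carrier_mat d d"
    and F: "\<And>c. c < d \<Longrightarrow> dfunc (\<lambda>e. F e $ c)" "\<And>e. F e \<in> carrier_vec d"
  shows "dpred M (\<lambda>e. P *\<^sub>v F e \<in> map_vec complex_of_real ` I)"
proof (rule dpred_complex_mem[OF assms(1,2)])
  fix l assume l: "l < d"
  have "dfunc (\<lambda>e. \<Sum>c<d. P $$ (l, c) * F e $ c)"
    by (intro dfunc_sum dfunc_mult dfunc_const F(1)) simp_all
  moreover have "(P *\<^sub>v F e) $ l = (\<Sum>c<d. P $$ (l, c) * F e $ c)" for e
    using l assms(3) F(2)[of e] by (simp add: scalar_prod_def atLeast0LessThan)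
  ultimately show "dfunc (\<lambda>e. (P *\<^sub>v F e) $ l)" by simp
qed (use assms(3) F(2) in simp)

end

theorem theorem2:
  fixes M :: "(exp_fun + 'f, exp_rel + 'r) real_structure"
    and A :: "rat Matrix.mat" and x :: "rat Matrix.vec"
    and P Pinv :: "complex Matrix.mat"
    and k d :: nat and ds :: "nat \<Rightarrow> nat"
    and \<rho> :: "nat \<Rightarrow> real" and lam :: "nat \<Rightarrow> complex"
    and I :: "real Matrix.vec set"
  assumes A: "A \<in> carrier_mat d d" "invertible_mat A"
    and x: "x \<in> carrier_vec d"
    and jordan: "similar_mat_wit (map_mat of_rat A) (jordan_matrix (block_list k ds \<rho> lam)) P Pinv"
    and blocks: "\<And>i. i < k \<Longrightarrow> ds i > 0"
    and moduli: "\<And>i. i < k \<Longrightarrow> \<rho> i > 0" "\<And>i. i < k \<Longrightarrow> cmod (lam i) = 1"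
    and last_block: "k \<ge> 1" "\<rho> (k - 1) > 1"
    and structure_M: "expands_R_exp M" "o_minimal M"
    and I: "I \<subseteq> carrier_vec d" "definable M d I" "loop_invariant A x I"
  shows "\<exists>t0\<ge>1. (\<lambda>y. P *\<^sub>v y) ` trajectory_cone k ds \<rho> lam (Pinv *\<^sub>v map_vec of_rat x) t0
                   \<subseteq> map_vec complex_of_real ` I"
proof -
  interpret o_minimal_expansion M by unfold_locales (fact structure_M)+
  let ?A = "map_mat of_rat A :: complex mat" and ?J = "jordan_matrix (block_list k ds \<rho> lam)"
    and ?x = "map_vec of_rat x :: complex vec"
  define x' where "x' = Pinv *\<^sub>v ?x"
  have carrier: "?J \<in> carrier_mat d d" "P \<in> carrier_mat d d" "Pinv \<in> carrier_mat d d"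
    and PPinv: "P * Pinv = 1\<^sub>m d" "Pinv * P = 1\<^sub>m d" and A_eq: "?A = P * ?J * Pinv"
    using jordan A(1) unfolding similar_mat_wit_def Let_def by auto
  have d: "(\<Sum>l<k. ds l) = d"
    using carrier_matD(1)[OF carrier(1)] by (simp add: sum_list_block_list)

  \<comment> \<open>Goodness along the loop\<close>
  define Y where "Y = cone_vec k ds \<rho> lam x'"
  have Y: "Y p s \<in> carrier_vec d" for p s unfolding Y_def d[symmetric] by simp
  define good where "good p s \<longleftrightarrow> P *\<^sub>v Y p s \<in> map_vec complex_of_real ` I" for p s
  have good_cong: "good p s \<longleftrightarrow> good q s" if "\<And>i. i < k \<Longrightarrow> p i = q i" for p q s
    unfolding good_def Y_def using cone_vec_cong[OF that] by simp
  have good_step: "good (\<lambda>i. lam i * p i) (s + 1)" if "good p s" for p s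
  proof -
    obtain v where v: "v \<in> I" "P *\<^sub>v Y p s = map_vec complex_of_real v"
      using \<open>good p s\<close> unfolding good_def by blast
    have "v \<in> carrier_vec d" using v I(1) by blast
    have "map_vec complex_of_real (map_mat of_rat A *\<^sub>v v) = ?A *\<^sub>v (P *\<^sub>v Y p s)"
    proof -
      have "map_mat complex_of_real (map_mat of_rat A) = ?A"
        by (intro eq_matI) (auto simp: complex_of_real_of_rat)
      then show ?thesis unfolding v(2)
        using map_vec_of_real_mult_mat_vec[of "map_mat of_rat A" d v] A(1) \<open>v \<in> carrier_vec d\<close> by simp
    qed
    also have "\<dots> = (P * ?J * Pinv * P) *\<^sub>v Y p s"
      unfolding A_eq using carrier Y by (intro assoc_mult_mat_vec[symmetric, of _ d d _ d]) auto
    also have "P * ?J * Pinv * P = P * ?J * (Pinv * P)"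
      using carrier by (intro assoc_mult_mat[of _ d d _ d _ d]) auto
    also have "\<dots> = P * ?J" unfolding PPinv using carrier by (intro right_mult_one_mat[of _ d]) auto
    also have "(P * ?J) *\<^sub>v Y p s = P *\<^sub>v (?J *\<^sub>v Y p s)"
      using carrier Y by (intro assoc_mult_mat_vec[of _ d d _ d]) auto
    also have "?J *\<^sub>v Y p s = Y (\<lambda>i. lam i * p i) (s + 1)"
      unfolding Y_def using moduli by (rule jordan_matrix_mult_cone_vec)
    finally have "P *\<^sub>v Y (\<lambda>i. lam i * p i) (s + 1) = map_vec complex_of_real (map_mat of_rat A *\<^sub>v v)" ..
    moreover have "map_mat of_rat A *\<^sub>v v \<in> I" using I(3) v(1) by (simp add: loop_invariant_def)
    ultimately show ?thesis unfolding good_def by (rule image_eqI)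
  qed
  have good_iter: "good (\<lambda>i. lam i ^ n * p i) (s + real n)" if "good p s" for n p s
  proof (induction n)
    case (Suc n)
    show ?case using good_step[OF Suc] by (simp add: ac_simps)
  qed (use that in simp)
  have "good (\<lambda>_. 1) 0"
  proof -
    have "?x \<in> carrier_vec d" using x by simp
    then have "x' \<in> carrier_vec d" using carrier by (simp add: x'_def)
    then have "Y (\<lambda>_. 1) 0 = x'" unfolding Y_def d[symmetric] by (rule cone_vec_1_0)
    then have "P *\<^sub>v Y (\<lambda>_. 1) 0 = (P * Pinv) *\<^sub>v ?x"
      unfolding x'_def using carrier \<open>?x \<in> carrier_vec d\<close>
      by (simp add: assoc_mult_mat_vec[of P d d Pinv d ?x])
    also have "\<dots> = map_vec complex_of_real (map_vec of_rat x)"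
      unfolding PPinv using \<open>?x \<in> carrier_vec d\<close>
      by (intro eq_vecI) (auto simp: complex_of_real_of_rat)
    finally show ?thesis using I(3) unfolding good_def loop_invariant_def by blast
  qed
  then have good_orbit: "good (\<lambda>i. lam i ^ n) (real n)" for n
    using good_iter[of "\<lambda>_. 1" 0 n] by simp

  \<comment> \<open>A box of chart parameters with a common threshold\<close>
  obtain R w B where R: "finite R" "R \<subseteq> {..<k}" and B: "finite B" "B \<subseteq> mult_relations k lam"
    and kernel: "\<forall>v\<in>mult_relations k lam. \<forall>j\<in>R. (\<Sum>i<k. v i * w j i) = 0"
    and solve: "\<forall>\<beta> :: nat \<Rightarrow> real. (\<forall>v\<in>B. (\<Sum>i<k. of_int (v i) * \<beta> i) = 0) \<longrightarrow>
      (\<exists>s. (\<forall>i\<in>{..<k}. \<beta> i = (\<Sum>j\<in>R. s j * of_int (w j i))) \<and> (\<forall>j\<in>R. \<bar>s j\<bar> \<le> \<bar>\<beta> j\<bar>))"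
    using integer_kernel_basis[of "{..<k}" "mult_relations k lam"] by auto
  define \<phi> where "\<phi> = torus_chart R w"
  have \<phi>_torus: "\<phi> e \<in> torus k lam" for e unfolding \<phi>_def using kernel by (rule torus_chart_in_torus)
  \<comment> \<open>The chart reads indices below \<open>k\<close> only, which leaves variable
    \<open>k\<close> free to carry \<open>s\<close>.\<close>
  have \<phi>_upd: "\<phi> (e(k := u)) = \<phi> e" for e u
    unfolding \<phi>_def using R(2) by (intro torus_chart_cong) auto

  have def_good: "dpred M (\<lambda>e. good (\<phi> e) (e k))"
    unfolding good_def Y_def \<phi>_def
    by (intro dpred_mult_mat_vec_mem[OF I(2,1) carrier(2)] dfunc_cone_vec dfunc_torus_chart R(1))
      (simp_all add: d Y[unfolded Y_def])
  \<comment> \<open>One number codes a threshold \<open>m div 2\<close> and, by its parity, the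
    eventual truth value, so a single countable family covers all parameters.\<close>
  define Q where "Q m e \<longleftrightarrow> (\<forall>u. \<not> real (m div 2) < (e(k := u)) k \<or>
      (good (\<phi> (e(k := u))) ((e(k := u)) k) \<longleftrightarrow> even m))" for m :: nat and e :: "nat \<Rightarrow> real"
  have Q_iff: "Q m e \<longleftrightarrow> (\<forall>s > real (m div 2). good (\<phi> e) s \<longleftrightarrow> even m)" for m e
    unfolding Q_def by (auto simp: \<phi>_upd)
  have def_Q: "dpred M (Q m)" for m
  proof -
    have "dpred M (\<lambda>e. good (\<phi> e) (e k) \<longleftrightarrow> even m)"
      by (cases "even m") (simp_all add: def_good dpred_neg)
    then have "dpred M (\<lambda>e. \<not> real (m div 2) < e k \<or> (good (\<phi> e) (e k) \<longleftrightarrow> even m))"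
      by (intro dpred_disj dpred_neg dpred_less dfun_const dfun_var)
    from dpred_all_upd[OF this, of k] show ?thesis by (simp only: Q_def[abs_def])
  qed
  have ex_Q: "\<exists>m. Q m e" for e
  proof -
    obtain m :: nat where "(\<forall>s > real m. good (\<phi> e) s) \<or> (\<forall>s > real m. \<not> good (\<phi> e) s)"
      using eventually_constant[OF def_good, of e k] by (auto simp: \<phi>_upd)
    then have "Q (2 * m) e \<or> Q (2 * m + 1) e" by (auto simp: Q_iff)
    then show ?thesis by blast
  qed
  \<comment> \<open>The unit box is an arbitrary starting box in the parameter space.\<close>
  have "\<exists>m a b. (\<forall>i<k. 0 \<le> a i \<and> a i < b i \<and> b i \<le> 1) \<and> (\<forall>e\<in>box k a b. Q m e)"
    by (rule countable_definable_cover) (simp_all add: def_Q ex_Q)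
  then obtain m a b where "\<forall>i<k. 0 \<le> a i \<and> a i < b i \<and> b i \<le> 1" and Q_box: "\<forall>e\<in>box k a b. Q m e"
    by (elim exE conjE)
  then have ab: "\<forall>i<k. a i < b i" and box: "\<And>e. e \<in> box k a b \<Longrightarrow> Q m e" by simp_all

  \<comment> \<open>From the box to an open part of the torus, and on to the whole torus\<close>
  define e0 where "e0 i = (a i + b i) / 2" for i
  have e0: "\<forall>i<k. a i < e0 i \<and> e0 i < b i" using ab by (simp add: e0_def)
  have solve': "\<exists>s. (\<forall>i<k. \<beta> i = (\<Sum>j\<in>R. s j * of_int (w j i))) \<and> (\<forall>j\<in>R. \<bar>s j\<bar> \<le> \<bar>\<beta> j\<bar>)"
    if "\<forall>v\<in>B. (\<Sum>i<k. of_int (v i) * \<beta> i) = 0" for \<beta> :: "nat \<Rightarrow> real"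
    using mp[OF spec[OF solve, of \<beta>] that] by (simp only: Ball_def lessThan_iff)
  obtain \<delta> where \<delta>: "\<delta> > 0" and open_chart: "\<forall>\<alpha>\<in>torus k lam. (\<forall>i<k. norm (\<alpha> i - \<phi> e0 i) < \<delta>) \<longrightarrow>
    (\<exists>e. (\<forall>i<k. a i < e i \<and> e i < b i) \<and> (\<forall>i\<ge>k. e i = 0) \<and> (\<forall>i<k. \<alpha> i = \<phi> e i))"
    using torus_chart_open[OF R(2) B kernel solve' e0] unfolding \<phi>_def by blast
  have chart: "good \<alpha> s \<longleftrightarrow> even m"
    if \<alpha>: "\<alpha> \<in> torus k lam" "\<forall>i<k. norm (\<alpha> i - \<phi> e0 i) < \<delta>" and s: "s > real (m div 2)" for \<alpha> s
  proof -
    obtain e where e: "e \<in> box k a b" "\<forall>i<k. \<alpha> i = \<phi> e i"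
      using open_chart \<alpha> unfolding box_def by blast
    have "good \<alpha> s \<longleftrightarrow> good (\<phi> e) s" using e(2) by (intro good_cong) simp
    then show ?thesis using box[OF e(1)] s by (simp add: Q_iff)
  qed
  have dense: "\<exists>n\<ge>nmin. \<forall>i<k. norm (lam i ^ n - \<alpha> i) < \<epsilon>" if "\<alpha> \<in> torus k lam" "\<epsilon> > 0" for \<alpha> \<epsilon> nmin
    using that moduli(2) by (intro orbit_dense_in_torus) (auto simp: torus_def mult_relations_def)
  have "even m"
  proof -
    \<comment> \<open>The successor puts \<open>n\<close> strictly beyond the threshold.\<close>
    obtain n where n: "n \<ge> Suc (m div 2)" "\<forall>i<k. norm (lam i ^ n - \<phi> e0 i) < \<delta>"
      using dense[OF \<phi>_torus \<delta>] by blast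
    then show ?thesis
      using chart[of "\<lambda>i. lam i ^ n" "real n"] torus_power[OF moduli(2)] good_orbit[of n] by simp
  qed
  obtain N where N: "\<forall>\<alpha>\<in>torus k lam. \<exists>n\<le>N. \<forall>i<k. norm (lam i ^ n - \<alpha> i) < \<delta>"
    using uniform_orbit_dense_in_torus[of "torus k lam" k lam \<delta>] dense[where nmin = 0] \<delta>
    by (auto simp: torus_def)
  have good_torus: "good p s" if p: "p \<in> torus k lam" and s: "s > real (m div 2 + N)" for p s
  proof -
    \<comment> \<open>Conjugation is inversion on the unit circle. If \<open>lam ^ n\<close> is near
      \<open>p / \<phi> e0\<close>, then \<open>q = p / lam ^ n\<close> is near
      \<open>\<phi> e0\<close>, and \<open>n\<close> iterations carry \<open>q\<close> at time
      \<open>s - n\<close> to \<open>p\<close> at time \<open>s\<close>.\<close>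
    have "(\<lambda>i. p i * cnj (\<phi> e0 i)) \<in> torus k lam" by (intro torus_mult torus_cnj p \<phi>_torus)
    then obtain n where n: "n \<le> N" "\<And>i. i < k \<Longrightarrow> norm (lam i ^ n - p i * cnj (\<phi> e0 i)) < \<delta>"
      using bspec[OF N] by blast
    define q where "q i = p i * cnj (lam i ^ n)" for i
    have unit: "norm (p i) = 1" "norm (\<phi> e0 i) = 1" "norm (lam i ^ n) = 1" if "i < k" for i
      using p \<phi>_torus[of e0] moduli(2) that by (auto simp: torus_def norm_power)
    have cnj_unit: "z * cnj z = 1" if "norm z = 1" for z
      using that by (simp add: complex_norm_square[symmetric])
    have "q \<in> torus k lam"
      unfolding q_def[abs_def] by (intro torus_mult torus_cnj torus_power p moduli(2))
    moreover have "norm (q i - \<phi> e0 i) < \<delta>" if i: "i < k" for i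
    proof -
      \<comment> \<open>The unimodular factor preserves the norm and turns this distance into the
        one controlled by the choice of \<open>n\<close>.\<close>
      have "norm (q i - \<phi> e0 i) = norm (lam i ^ n * cnj (\<phi> e0 i) * (q i - \<phi> e0 i))"
        using unit[OF i] by (simp add: norm_mult)
      also have "lam i ^ n * cnj (\<phi> e0 i) * (q i - \<phi> e0 i)
          = p i * cnj (\<phi> e0 i) * (lam i ^ n * cnj (lam i ^ n)) - lam i ^ n * (\<phi> e0 i * cnj (\<phi> e0 i))"
        by (simp only: q_def algebra_simps)
      also have "\<dots> = p i * cnj (\<phi> e0 i) - lam i ^ n"
        unfolding cnj_unit[OF unit(2)[OF i]] cnj_unit[OF unit(3)[OF i]] by simp
      finally show ?thesis using n(2)[OF i] by (simp add: norm_minus_commute)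
    qed
    ultimately have "good q (s - real n)"
      using chart[of q "s - real n"] s n(1) \<open>even m\<close> by simp
    from good_iter[OF this, of n] have "good (\<lambda>i. lam i ^ n * q i) s" by simp
    moreover have "lam i ^ n * q i = p i" if "i < k" for i
    proof -
      have "lam i ^ n * q i = p i * (lam i ^ n * cnj (lam i ^ n))" by (simp only: q_def mult_ac)
      then show ?thesis unfolding cnj_unit[OF unit(3)[OF that]] by simp
    qed
    ultimately show ?thesis using good_cong[of "\<lambda>i. lam i ^ n * q i" p s] by simp
  qed

  \<comment> \<open>The added 1 turns the weak inequality
    \<open>s \<ge> log (\<rho> (k - 1)) t0\<close> on the ray into the strict one that
    \<open>good_torus\<close> demands.\<close>
  define t0 where "t0 = \<rho> (k - 1) powr (real (m div 2 + N) + 1)"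
  have t0: "t0 \<ge> 1" "log (\<rho> (k - 1)) t0 = real (m div 2 + N) + 1"
    unfolding t0_def using last_block(2) by (simp_all add: ge_one_powr_ge_zero)
  have "P *\<^sub>v y \<in> map_vec complex_of_real ` I" if y: "y \<in> trajectory_cone k ds \<rho> lam x' t0" for y
  proof -
    obtain p where p: "p \<in> torus k lam" "y \<in> ray k ds \<rho> lam x' p t0"
      using y unfolding trajectory_cone_def by blast
    obtain s where "s \<ge> log (\<rho> (k - 1)) t0" "y = Y p s"
      unfolding Y_def using ray_subset_cone_vec[OF p(2) t0(1) last_block(2) moduli(1)] by blast
    then show ?thesis using good_torus[OF p(1), of s] t0(2) by (simp add: good_def)
  qed
  then show ?thesis using t0(1) unfolding x'_def by blast
qed

end
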